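(* Let $(A_1,\dots,A_k)\in SL(2,\mathbb{R})^k$ and let $\mathcal{A}:\Sigma\to SL(2,\mathbb{R})$, $\mathcal{A}(x)=A_{x_0}$, be the one-step cocycle it generates over the shift $T$ on $\Sigma=\{1,\dots,k\}^{\mathbb{Z}}$. Assume that $\mathcal{A}$ is pinching and twisting. Let $\mathcal{K}\subset\Sigma$ be the Mather set of $\mathcal{A}$, and let $e_1,e_2:\mathcal{K}\to\mathbb{P}\mathbb{R}^2$ be the continuous maps giving the dominated splitting of $\mathcal{A}$ over $\mathcal{K}$. Suppose that $e_1$ and $e_2$ are one-to-one on $\mathcal{K}$, in the sense that for all $x,y\in\mathcal{K}$, $e_1(x)=e_1(y)$ implies $x_-=y_-$, and $e_2(x)=e_2(y)$ implies $x_+=y_+$. Then $h_\mu(T)=0$ for every Lyapunov maximizing measure $\mu$ of $\mathcal{A}$.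
   Context: $T:\Sigma\to\Sigma$ is the shift $T(x_l)_{l\in\mathbb{Z}}=(x_{l+1})_{l\in\mathbb{Z}}$. For $x\in\Sigma$ write $x_-=(\dots,x_{-2},x_{-1})$ and $x_+=(x_0,x_1,\dots)$. Put $\mathcal{A}^n(x)=A_{x_{n-1}}\cdots A_{x_0}$, and for a finite word $I=i_0\cdots i_{n-1}$ put $\mathcal{A}_I=A_{i_{n-1}}\cdots A_{i_0}$ (the identity for the empty word). $\sigma_1(A)\ge\sigma_2(A)$ denote the singular values of a $2\times2$ matrix $A$. Pinching: for every $\kappa>1$ there is a finite word $I$ with $\sigma_1(\mathcal{A}_I)/\sigma_2(\mathcal{A}_I)>\kappa$. Twisting: for all lines (one-dimensional subspaces) $G,F_1,\dots,F_n\subset\mathbb{R}^2$ there is a finite word $J$ with $\mathcal{A}_J(G)\notin\{F_1,\dots,F_n\}$. For a $T$-invariant Borel probability measure $\mu$ on $\Sigma$, $\chi(\mu,\mathcal{A})=\lim_{n}\frac1n\int\log\|\mathcal{A}^n(x)\|\,d\mu(x)$ is the top Lyapunov exponent. $\beta(\mathcal{A})=\lim_{n\to\infty}\frac1n\log\sup_{x\in\Sigma}\|\mathcal{A}^n(x)\|=\sup_\mu\chi(\mu,\mathcal{A})$ is the maximal Lyapunov exponent. A Lyapunov maximizing measure is a $T$-invariant Borel probability measure $\mu$ with $\chi(\mu,\mathcal{A})=\beta(\mathcal{A})$. The Mather set $\mathcal{K}$ is the union of the supports of all Lyapunov maximizing measures; it is nonempty, compact and $T$-invariant. $h_\mu(T)$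 is the Kolmogorov–Sinai entropy. Known fact: a pinching and twisting one-step $SL(2,\mathbb{R})$-cocycle is dominated over $\mathcal{K}$, i.e. there are continuous maps $e_1,e_2:\mathcal{K}\to\mathbb{P}\mathbb{R}^2$ (points of $\mathbb{P}\mathbb{R}^2$ being lines in $\mathbb{R}^2$) with $\mathbb{R}^2=e_1(\omega)\oplus e_2(\omega)$, $\mathcal{A}(\omega)e_i(\omega)=e_i(T\omega)$ for $i=1,2$, and constants $c>0$, $0<\delta<1$ with $\|\mathcal{A}^n(\omega)|_{e_1(\omega)}\|\ge c\,e^{\delta n}\,\|\mathcal{A}^n(\omega)|_{e_2(\omega)}\|$ for all $\omega\in\mathcal{K}$, $n\ge1$. The direction $e_1(\omega)$ depends only on $\omega_-$ and $e_2(\omega)$ only on $\omega_+$. *)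

theory Defs
  imports "HOL-Probability.Probability_Measure"
begin

section \<open>The two-sided shift on \<open>k\<close> symbols\<close>

text \<open>A point of \<open>\<Sigma> = {1,\<dots>,k}\<^sup>\<int>\<close> is a function of type \<^typ>\<open>int \<Rightarrow> nat\<close>. Since \<^typ>\<open>nat\<close> carries the
  discrete topology, the topology of \<open>\<Sigma>\<close> is the one induced by the product topology of the type
  \<^typ>\<open>int \<Rightarrow> nat\<close>.\<close>

definition Sigma_space :: "nat \<Rightarrow> (int \<Rightarrow> nat) set" where
  "Sigma_space k = {x. \<forall>l. x l \<in> {1..k}}"

definition left_shift :: "(int \<Rightarrow> nat) \<Rightarrow> (int \<Rightarrow> nat)" where
  "left_shift x = (\<lambda>l. x (l + 1))"

definition invariant_prob_measure :: "nat \<Rightarrow> (int \<Rightarrow> nat) measure \<Rightarrow> bool" where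
  "invariant_prob_measure k M \<longleftrightarrow>
     prob_space M \<and> sets M = sets (restrict_space borel (Sigma_space k)) \<and>
     distr M M left_shift = M"

definition measure_support :: "'a::topological_space measure \<Rightarrow> 'a set" where
  "measure_support M = {x \<in> space M. \<forall>U. open U \<longrightarrow> x \<in> U \<longrightarrow> emeasure M (U \<inter> space M) > 0}"

section \<open>One-step cocycles\<close>

primrec word_product :: "(nat \<Rightarrow> real^2^2) \<Rightarrow> nat list \<Rightarrow> real^2^2" where
  "word_product A [] = mat 1"
| "word_product A (i # I) = word_product A I ** A i"

definition words :: "nat \<Rightarrow> nat list set" where
  "words k = lists {1..k}"

primrec cocycle :: "(nat \<Rightarrow> real^2^2) \<Rightarrow> nat \<Rightarrow> (int \<Rightarrow> nat) \<Rightarrow> real^2^2" where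
  "cocycle A 0 x = mat 1"
| "cocycle A (Suc n) x = A (x (int n)) ** cocycle A n x"

abbreviation op_norm :: "real^2^2 \<Rightarrow> real" where
  "op_norm B \<equiv> onorm ((*v) B)"

definition eigenvalues :: "real^2^2 \<Rightarrow> real set" where
  "eigenvalues B = {a. \<exists>v. v \<noteq> 0 \<and> B *v v = a *\<^sub>R v}"

text \<open>The singular values of \<open>B\<close> are the square roots of the eigenvalues of the symmetric matrix
  \<open>B\<^sup>T B\<close>; if this matrix has a single eigenvalue, it is a double one.\<close>

definition sigma1 :: "real^2^2 \<Rightarrow> real" where
  "sigma1 B = sqrt (Max (eigenvalues (transpose B ** B)))"

definition sigma2 :: "real^2^2 \<Rightarrow> real" where
  "sigma2 B = sqrt (Min (eigenvalues (transpose B ** B)))"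

definition pinching :: "nat \<Rightarrow> (nat \<Rightarrow> real^2^2) \<Rightarrow> bool" where
  "pinching k A \<longleftrightarrow>
     (\<forall>\<kappa>>1. \<exists>I\<in>words k. sigma1 (word_product A I) / sigma2 (word_product A I) > \<kappa>)"

definition lines :: "(real^2) set set" where
  "lines = {L. subspace L \<and> dim L = 1}"

definition twisting :: "nat \<Rightarrow> (nat \<Rightarrow> real^2^2) \<Rightarrow> bool" where
  "twisting k A \<longleftrightarrow>
     (\<forall>G\<in>lines. \<forall>F. finite F \<longrightarrow> F \<subseteq> lines \<longrightarrow>
        (\<exists>J\<in>words k. (*v) (word_product A J) ` G \<notin> F))"

section \<open>Lyapunov maximizing measures and the Mather set\<close>

definition lyapunov_exponent :: "(nat \<Rightarrow> real^2^2) \<Rightarrow> (int \<Rightarrow> nat) measure \<Rightarrow> real" where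
  "lyapunov_exponent A M = lim (\<lambda>n. (1 / real n) * (\<integral>x. ln (op_norm (cocycle A n x)) \<partial>M))"

definition max_lyapunov_exponent :: "nat \<Rightarrow> (nat \<Rightarrow> real^2^2) \<Rightarrow> real" where
  "max_lyapunov_exponent k A =
     lim (\<lambda>n. (1 / real n) * ln (SUP x\<in>Sigma_space k. op_norm (cocycle A n x)))"

definition lyapunov_maximizing :: "nat \<Rightarrow> (nat \<Rightarrow> real^2^2) \<Rightarrow> (int \<Rightarrow> nat) measure \<Rightarrow> bool" where
  "lyapunov_maximizing k A M \<longleftrightarrow>
     invariant_prob_measure k M \<and> lyapunov_exponent A M = max_lyapunov_exponent k A"

definition mather_set :: "nat \<Rightarrow> (nat \<Rightarrow> real^2^2) \<Rightarrow> (int \<Rightarrow> nat) set" where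
  "mather_set k A = \<Union> (measure_support ` {M. lyapunov_maximizing k A M})"

section \<open>The projective line and dominated splittings\<close>

text \<open>The quotient topology with respect to \<open>v \<mapsto> span {v}\<close> on the nonzero vectors.\<close>

definition projective_line :: "(real^2) set topology" where
  "projective_line = topology (\<lambda>U. U \<subseteq> lines \<and> open {v. v \<noteq> 0 \<and> span {v} \<in> U})"

lemma openin_projective_line:
  "openin projective_line U \<longleftrightarrow> U \<subseteq> lines \<and> open {v. v \<noteq> 0 \<and> span {v} \<in> U}"
proof -
  have "istopology (\<lambda>U. U \<subseteq> lines \<and> open {v::real^2. v \<noteq> 0 \<and> span {v} \<in> U})"
    unfolding istopology_def
  proof (intro conjI allI impI)
    fix S T :: "(real^2) set set"
    assume S: "S \<subseteq> lines \<and> open {v. v \<noteq> 0 \<and> span {v} \<in> S}"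
      and T: "T \<subseteq> lines \<and> open {v. v \<noteq> 0 \<and> span {v} \<in> T}"
    then show "S \<inter> T \<subseteq> lines" by blast
    have "{v. v \<noteq> 0 \<and> span {v} \<in> S \<inter> T}
        = {v. v \<noteq> 0 \<and> span {v} \<in> S} \<inter> {v. v \<noteq> 0 \<and> span {v} \<in> T}" by blast
    then show "open {v. v \<noteq> 0 \<and> span {v} \<in> S \<inter> T}" using S T by auto
  next
    fix \<K> :: "(real^2) set set set"
    assume K: "\<forall>K\<in>\<K>. K \<subseteq> lines \<and> open {v. v \<noteq> 0 \<and> span {v} \<in> K}"
    then show "\<Union> \<K> \<subseteq> lines" by blast
    have "{v. v \<noteq> 0 \<and> span {v} \<in> \<Union> \<K>} = (\<Union>K\<in>\<K>. {v. v \<noteq> 0 \<and> span {v} \<in> K})" by blast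
    then show "open {v. v \<noteq> 0 \<and> span {v} \<in> \<Union> \<K>}" using K by auto
  qed
  then show ?thesis by (simp add: projective_line_def)
qed

lemma span_singleton_in_lines: "v \<noteq> 0 \<Longrightarrow> span {v} \<in> lines"
  by (simp add: lines_def subspace_span dim_span dim_singleton)

lemma topspace_projective_line: "topspace projective_line = lines"
proof -
  have "{v::real^2. v \<noteq> 0 \<and> span {v} \<in> lines} = - {0}"
    using span_singleton_in_lines by auto
  then have "openin projective_line lines"
    by (simp add: openin_projective_line open_Compl)
  then show ?thesis
    by (metis openin_projective_line openin_subset openin_topspace subset_antisym)
qed

definition norm_on :: "real^2^2 \<Rightarrow> (real^2) set \<Rightarrow> real" where
  "norm_on B L = (SUP v\<in>{v \<in> L. norm v = 1}. norm (B *v v))"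

definition direct_sum_decomposition :: "(real^2) set \<Rightarrow> (real^2) set \<Rightarrow> bool" where
  "direct_sum_decomposition L1 L2 \<longleftrightarrow> {u + v | u v. u \<in> L1 \<and> v \<in> L2} = UNIV \<and> L1 \<inter> L2 = {0}"

definition dominated_splitting ::
  "(nat \<Rightarrow> real^2^2) \<Rightarrow> (int \<Rightarrow> nat) set \<Rightarrow> ((int \<Rightarrow> nat) \<Rightarrow> (real^2) set) \<Rightarrow>
   ((int \<Rightarrow> nat) \<Rightarrow> (real^2) set) \<Rightarrow> bool" where
  "dominated_splitting A K e1 e2 \<longleftrightarrow>
     continuous_map (top_of_set K) projective_line e1 \<and>
     continuous_map (top_of_set K) projective_line e2 \<and>
     (\<forall>\<omega>\<in>K. direct_sum_decomposition (e1 \<omega>) (e2 \<omega>)) \<and>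
     (\<forall>\<omega>\<in>K. (*v) (A (\<omega> 0)) ` e1 \<omega> = e1 (left_shift \<omega>) \<and>
             (*v) (A (\<omega> 0)) ` e2 \<omega> = e2 (left_shift \<omega>)) \<and>
     (\<exists>c>0. \<exists>\<delta>. 0 < \<delta> \<and> \<delta> < 1 \<and>
        (\<forall>\<omega>\<in>K. \<forall>n\<ge>1. norm_on (cocycle A n \<omega>) (e1 \<omega>) \<ge>
                      c * exp (\<delta> * real n) * norm_on (cocycle A n \<omega>) (e2 \<omega>)))"

section \<open>Kolmogorov--Sinai entropy\<close>

definition finite_measurable_partition :: "'a measure \<Rightarrow> 'a set set \<Rightarrow> bool" where
  "finite_measurable_partition M P \<longleftrightarrow> finite P \<and> P \<subseteq> sets M \<and> partition_on (space M) P"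

text \<open>The convention \<open>0 log 0 = 0\<close> is built in, as \<^term>\<open>ln (0::real)\<close> is multiplied by \<open>0\<close>.\<close>

definition partition_entropy :: "'a measure \<Rightarrow> 'a set set \<Rightarrow> real" where
  "partition_entropy M P = - (\<Sum>C\<in>P. measure M C * ln (measure M C))"

text \<open>\<open>iterated_join M T P n\<close> is \<open>P \<or> T\<^sup>-\<^sup>1P \<or> \<dots> \<or> T\<^sup>-\<^sup>(\<^sup>n\<^sup>-\<^sup>1\<^sup>)P\<close>, the empty cells being discarded.\<close>

primrec iterated_join :: "'a measure \<Rightarrow> ('a \<Rightarrow> 'a) \<Rightarrow> 'a set set \<Rightarrow> nat \<Rightarrow> 'a set set" where
  "iterated_join M T P 0 = {space M}"
| "iterated_join M T P (Suc n) =
     {C \<inter> ((T ^^ n) -` D \<inter> space M) | C D. C \<in> iterated_join M T P n \<and> D \<in> P} - {{}}"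

definition partition_dynamical_entropy :: "'a measure \<Rightarrow> ('a \<Rightarrow> 'a) \<Rightarrow> 'a set set \<Rightarrow> real" where
  "partition_dynamical_entropy M T P =
     lim (\<lambda>n. (1 / real n) * partition_entropy M (iterated_join M T P n))"

definition KS_entropy :: "'a measure \<Rightarrow> ('a \<Rightarrow> 'a) \<Rightarrow> ereal" where
  "KS_entropy M T =
     (SUP P\<in>{P. finite_measurable_partition M P}. ereal (partition_dynamical_entropy M T P))"

end

theory Submission
  imports Defs "HOL-Probability.Information"
begin

text \<open>By irreducibility there is an extremal norm \<open>N\<close>: no generator expands it by more than \<open>exp \<beta>\<close>.
  Along the direction \<open>e1\<close> over the Mather set it is expanded by exactly \<open>exp \<beta>\<close>. Splitting a vector
  of \<open>e1 x\<close> along \<open>e1 y\<close> and \<open>e2 y\<close> and following the future of \<open>y\<close> gives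
  \<open>\<bar>u \<and> g\<bar> N(v) \<le> \<bar>v \<and> g\<bar> N(u)\<close> for \<open>u \<in> e1 x\<close>, \<open>v \<in> e1 y\<close>, \<open>g \<in> e2 y\<close>. So two different
  futures of one past span a cone in which that past maximizes \<open>\<bar>u \<and> w\<bar> / N(u)\<close>; since \<open>e1\<close> separates
  pasts, these cones are disjoint, and all but countably many pasts in the Mather set have a unique
  future. By Poincare recurrence the countably many exceptions are harmless, so almost surely the past
  determines the next symbol, which forces zero entropy.\<close>

section \<open>Linear algebra and subadditivity\<close>

text \<open>Exactness of the growth along \<open>e1\<close> is what shapes the argument. In the
  Euclidean norm two directions could be compared only up to a multiplicative constant, and
  overlapping cones would then be no contradiction. With \<open>N\<close> the constant is one, so a
  common point of two cones forces equality throughout and identifies the two directions. The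
  exceptional pasts cannot be discarded as null: the set of points with one given past may have
  positive measure, for instance for an atomic measure on a periodic orbit. This is where recurrence
  enters. The passage to zero entropy does not go through a generating partition. Entropy is a
  supremum over all finite partitions, and each of them is treated directly by a code: an initial
  window, together with reports that are informative only on a set of small measure, determines the
  whole itinerary, so the entropy spent per step is arbitrarily small.\<close>

lemma subadditive_tendsto_Inf:
  fixes a :: "nat \<Rightarrow> real"
  assumes nonneg: "\<And>n. 0 \<le> a n" and sub: "\<And>m n. a (m + n) \<le> a m + a n"
  obtains L where "(\<lambda>n. a n / real n) \<longlonglongrightarrow> L" "\<And>n. real n * L \<le> a n"
proof -
  \<comment> \<open>Fekete's lemma: the limit is the infimum of the quotients. The second
    conclusion, a bound at every \<open>n\<close>, later makes an exponent a lower bound for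
    integrals.\<close>
  define L where "L = (INF n\<in>{1..}. a n / real n)"
  have bdd: "bdd_below ((\<lambda>n. a n / real n) ` {1..})"
    by (rule bdd_belowI[of _ 0]) (use nonneg in auto)
  have L_le: "L \<le> a n / real n" if "n \<ge> 1" for n
    unfolding L_def using that by (intro cINF_lower bdd) auto
  have mult: "a (q * m) \<le> real q * a m" if "q \<ge> 1" for q m
    using that
  proof (induction q rule: nat_induct_at_least)
    case (Suc q)
    have "a (Suc q * m) \<le> a m + a (q * m)" using sub[of m "q * m"] by simp
    with Suc show ?case by (simp add: algebra_simps)
  qed simp
  have "(\<lambda>n. a n / real n) \<longlonglongrightarrow> L"
  proof (rule LIMSEQ_I)
    fix r :: real assume r: "r > 0"
    have "\<exists>m\<in>{1..}. a m / real m < L + r / 2"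
      using cINF_less_iff[OF _ bdd, of "L + r / 2"] r by (auto simp: L_def)
    then obtain m where m: "m \<ge> 1" "a m / real m < L + r / 2" by auto
    define b where "b = Max (a ` {..m})"
    have b: "a i \<le> b" if "i \<le> m" for i unfolding b_def using that by (intro Max_ge) auto
    have b0: "b \<ge> 0" using b[of 0] nonneg[of 0] by simp
    obtain M :: nat where M: "b / (r / 2) < real M" using reals_Archimedean2 by blast
    show "\<exists>no. \<forall>n\<ge>no. norm (a n / real n - L) < r"
    proof (intro exI allI impI)
      fix n assume n: "n \<ge> max M m"
      then have n0: "n > 0" "n div m \<ge> 1" using m by (auto simp: div_greater_zero_iff Suc_le_eq)
      have "a n \<le> a (n div m * m) + a (n mod m)" using sub[of "n div m * m" "n mod m"] by simp
      also have "\<dots> \<le> real (n div m) * a m + b"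
        using mult[OF n0(2), of m] b[of "n mod m"] m(1) by (intro add_mono) (auto intro: less_imp_le)
      also have "\<dots> = (real (n div m) * real m) * (a m / real m) + b" using m by simp
      also have "\<dots> \<le> real n * (a m / real m) + b"
      proof -
        have "real (n div m) * real m \<le> real n"
          by (metis div_times_less_eq_dividend of_nat_le_iff of_nat_mult)
        then show ?thesis using nonneg[of m] by (intro add_right_mono mult_right_mono) auto
      qed
      finally have "a n / real n \<le> a m / real m + b / real n"
        using n0 by (simp add: field_simps)
      moreover have "b / real n < r / 2"
      proof -
        have "b < real M * (r / 2)" using M r by (simp add: field_simps)
        also have "\<dots> \<le> real n * (r / 2)" using n r by (intro mult_right_mono) auto
        finally show ?thesis using n0 by (simp add: field_simps)
      qed
      moreover have "L \<le> a n / real n" using L_le n0 by simp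
      ultimately show "norm (a n / real n - L) < r"
        using m(2) unfolding real_norm_def by linarith
    qed
  qed
  moreover have "real n * L \<le> a n" for n
  proof (cases "n = 0")
    case False
    then show ?thesis using L_le[of n] by (simp add: field_simps)
  qed (use nonneg in simp)
  ultimately show thesis by (rule that)
qed

section \<open>Plane geometry through the determinant \<open>wedge\<close>\<close>

definition wedge :: "real^2 \<Rightarrow> real^2 \<Rightarrow> real" where
  "wedge u v = u $ 1 * v $ 2 - u $ 2 * v $ 1"

lemma vec2_eq_iff: "u = v \<longleftrightarrow> u $ 1 = v $ 1 \<and> u $ 2 = (v :: real^2) $ 2"
  by (simp add: vec_eq_iff forall_2)

lemma wedge_simps [simp]:
  "wedge (u + v) w = wedge u w + wedge v w" "wedge w (u + v) = wedge w u + wedge w v"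
  "wedge (u - v) w = wedge u w - wedge v w" "wedge w (u - v) = wedge w u - wedge w v"
  "wedge (t *\<^sub>R u) w = t * wedge u w" "wedge w (t *\<^sub>R u) = t * wedge w u"
  "wedge u u = 0" "wedge 0 u = 0" "wedge u 0 = 0"
  "wedge (- u) w = - wedge u w" "wedge w (- u) = - wedge w u"
  by (simp_all add: wedge_def algebra_simps)

lemma wedge_swap: "wedge v u = - wedge u v"
  by (simp add: wedge_def)

lemma wedge_matrix_vector_mult: "wedge (B *v u) (B *v v) = det B * wedge u v"
  by (simp add: wedge_def matrix_vector_mult_def sum_2 det_2 algebra_simps)

lemma abs_wedge_le: "\<bar>wedge u v\<bar> \<le> norm u * norm v"
proof -
  \<comment> \<open>Lagrange's identity; the square of the inner product is then discarded.\<close>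
  have "(wedge u v)\<^sup>2 + (u \<bullet> v)\<^sup>2 = (norm u)\<^sup>2 * (norm v)\<^sup>2"
    unfolding power2_norm_eq_inner
    by (simp add: wedge_def inner_vec_def sum_2 power2_eq_square algebra_simps)
  then have "(wedge u v)\<^sup>2 \<le> (norm u * norm v)\<^sup>2"
    by (simp add: power_mult_distrib) (smt (verit) zero_le_power2)
  then show ?thesis by (metis abs_le_square_iff abs_of_nonneg mult_nonneg_nonneg norm_ge_zero)
qed

text \<open>Cramer's rule in the basis \<open>u\<close>, \<open>f\<close>.\<close>

lemma wedge_decompose:
  assumes "wedge u f \<noteq> 0"
  shows "w = (wedge w f / wedge u f) *\<^sub>R u + (wedge u w / wedge u f) *\<^sub>R f"
proof -
  have "wedge u f *\<^sub>R w = wedge w f *\<^sub>R u + wedge u w *\<^sub>R f"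
    by (simp add: vec2_eq_iff wedge_def algebra_simps)
  then have "(1 / wedge u f) *\<^sub>R (wedge u f *\<^sub>R w)
      = (1 / wedge u f) *\<^sub>R (wedge w f *\<^sub>R u + wedge u w *\<^sub>R f)" by simp
  then show ?thesis using assms by (simp add: scaleR_add_right)
qed

lemma wedge_eq_0_iff:
  assumes "u \<noteq> 0"
  shows "wedge u v = 0 \<longleftrightarrow> v \<in> span {u}"
proof
  assume 0: "wedge u v = 0"
  then show "v \<in> span {u}"
  proof (cases "u $ 1 = 0")
    case True
    then have "u $ 2 \<noteq> 0" using assms by (simp add: vec2_eq_iff)
    then have "v = (v $ 2 / u $ 2) *\<^sub>R u" using True 0 by (simp add: vec2_eq_iff wedge_def)
    then show ?thesis by (metis span_breakdown_eq span_scale span_base singletonI)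
  next
    case False
    then have "v = (v $ 1 / u $ 1) *\<^sub>R u" using 0 by (simp add: vec2_eq_iff wedge_def field_simps)
    then show ?thesis by (metis span_scale span_base singletonI)
  qed
qed (auto simp: span_singleton)

lemma lines_eq_span:
  assumes "L \<in> lines" "v \<in> L" "v \<noteq> 0"
  shows "L = span {v}"
proof -
  have L: "subspace L" "dim L = 1" using assms by (auto simp: lines_def)
  have "span {v} \<subseteq> L" using L assms by (intro span_minimal) auto
  moreover have "dim L \<le> dim (span {v})" using L assms by (simp add: dim_span dim_singleton)
  ultimately show ?thesis
    using L by (metis subspace_dim_equal subspace_span)
qed

lemma lines_obtain_nonzero:
  assumes "L \<in> lines"
  obtains v where "v \<in> L" "v \<noteq> 0"
proof -
  have "dim L = 1" "subspace L" using assms by (auto simp: lines_def)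
  then have "\<not> L \<subseteq> {0}" by (metis dim_eq_0 zero_neq_one)
  then show thesis using that by blast
qed

lemma lines_obtain_unit:
  assumes "L \<in> lines"
  obtains v where "v \<in> L" "norm v = 1"
proof -
  obtain v where v: "v \<in> L" "v \<noteq> 0" using lines_obtain_nonzero[OF assms] .
  then have "(1 / norm v) *\<^sub>R v \<in> L" using assms by (auto simp: lines_def subspace_scale)
  moreover have "norm ((1 / norm v) *\<^sub>R v) = 1" using v by simp
  ultimately show thesis by (rule that)
qed

lemma lines_scale: "L \<in> lines \<Longrightarrow> v \<in> L \<Longrightarrow> t *\<^sub>R v \<in> L"
  by (auto simp: lines_def subspace_scale)

text \<open>A line has only two unit vectors, opposite to each other, so the supremum in
  \<open>norm_on\<close> runs over one value. This turns domination into an inequality between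
  individual vectors.\<close>

lemma norm_on_lines:
  assumes L: "L \<in> lines" and v: "v \<in> L"
  shows "norm (B *v v) = norm_on B L * norm v"
proof (cases "v = 0")
  case False
  have "(\<lambda>w. norm (B *v w)) ` {w \<in> L. norm w = 1} = {norm (B *v v) / norm v}"
  proof (intro equalityI subsetI)
    fix r assume "r \<in> (\<lambda>w. norm (B *v w)) ` {w \<in> L. norm w = 1}"
    then obtain w where w: "w \<in> L" "norm w = 1" "r = norm (B *v w)" by auto
    then obtain t where t: "w = t *\<^sub>R v" using lines_eq_span[OF L v False] by (auto simp: span_singleton)
    then have "\<bar>t\<bar> * norm v = 1" using w by simp
    then have "\<bar>t\<bar> = 1 / norm v" using False by (simp add: field_simps)
    moreover have "r = \<bar>t\<bar> * norm (B *v v)"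
      unfolding w(3) t by (simp add: matrix_vector_mult_scaleR)
    ultimately show "r \<in> {norm (B *v v) / norm v}" by simp
  next
    fix r assume r: "r \<in> {norm (B *v v) / norm v}"
    have "(1 / norm v) *\<^sub>R v \<in> {w \<in> L. norm w = 1}" using lines_scale[OF L v] False by simp
    moreover have "r = norm (B *v ((1 / norm v) *\<^sub>R v))"
      using r by (simp add: matrix_vector_mult_scaleR)
    ultimately show "r \<in> (\<lambda>w. norm (B *v w)) ` {w \<in> L. norm w = 1}" by blast
  qed
  then show ?thesis using False by (simp add: norm_on_def)
qed simp

lemma norm_le_op_norm: "norm (B *v v) \<le> op_norm B * norm v"
  by (rule onorm[OF matrix_vector_mul_bounded_linear])

lemma op_norm_nonneg: "0 \<le> op_norm B"
  by (rule onorm_pos_le[OF matrix_vector_mul_bounded_linear])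

lemma op_norm_mult_le: "op_norm (B ** C) \<le> op_norm B * op_norm C"
  using onorm_compose[OF matrix_vector_mul_bounded_linear[of B] matrix_vector_mul_bounded_linear[of C]]
  by (simp add: comp_def matrix_vector_mul_assoc)

lemma op_norm_mat_1: "op_norm (mat 1) = 1"
proof -
  have "((*v) (mat 1 :: real^2^2)) = (\<lambda>v. v)" by (simp add: fun_eq_iff)
  then show ?thesis by (simp add: onorm_id)
qed

text \<open>A map that preserves area cannot strictly shorten both of two orthonormal vectors. Hence
  logarithms of cocycle norms are nonnegative.\<close>

lemma op_norm_ge_1:
  assumes "det B = 1" shows "1 \<le> op_norm B"
proof -
  let ?u = "vector [1, 0] :: real^2" and ?v = "vector [0, 1] :: real^2"
  have n: "norm ?u = 1" "norm ?v = 1" by (simp_all add: norm_vec_def L2_set_def sum_2)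
  have "1 = \<bar>wedge (B *v ?u) (B *v ?v)\<bar>" by (simp add: wedge_matrix_vector_mult assms) (simp add: wedge_def)
  also have "\<dots> \<le> norm (B *v ?u) * norm (B *v ?v)" by (rule abs_wedge_le)
  also have "\<dots> \<le> op_norm B * op_norm B"
    using norm_le_op_norm[of B ?u] norm_le_op_norm[of B ?v] n op_norm_nonneg
    by (intro mult_mono) auto
  finally have "1\<^sup>2 \<le> (op_norm B)\<^sup>2" by (simp add: power2_eq_square)
  then show ?thesis using op_norm_nonneg power2_le_imp_le by blast
qed

lemma matrix_vector_mult_neq_0:
  assumes "det (B :: real^2^2) = 1" "v \<noteq> 0"
  shows "B *v v \<noteq> 0"
proof
  \<comment> \<open>\<open>?w\<close> is \<open>v\<close> turned by a right angle, so
    \<open>wedge v ?w\<close> is the squared norm of \<open>v\<close>.\<close>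
  let ?w = "vector [- v $ 2, v $ 1] :: real^2"
  assume "B *v v = 0"
  then have "wedge v ?w = 0" using wedge_matrix_vector_mult[of B v ?w] assms by simp
  then have "v $ 1 * v $ 1 + v $ 2 * v $ 2 = 0" by (simp add: wedge_def)
  then show False using assms by (simp add: vec2_eq_iff sum_squares_eq_zero_iff)
qed

section \<open>Products along words and orbits\<close>

lemma word_product_append: "word_product A (I @ J) = word_product A J ** word_product A I"
  by (induction I) (auto simp: matrix_mul_assoc)

lemma cocycle_eq_word_product: "cocycle A n x = word_product A (map (\<lambda>i. x (int i)) [0..<n])"
  by (induction n) (auto simp: word_product_append)

lemma left_shift_funpow: "(left_shift ^^ n) x = (\<lambda>l. x (l + int n))"
  by (induction n arbitrary: x) (auto simp: left_shift_def algebra_simps)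

lemma cocycle_add: "cocycle A (m + n) x = cocycle A m ((left_shift ^^ n) x) ** cocycle A n x"
  by (induction m) (auto simp: left_shift_funpow matrix_mul_assoc algebra_simps)

lemma words_obtain_point:
  assumes I: "I \<in> words k" and k: "k \<ge> 1"
  obtains x where "x \<in> Sigma_space k" "cocycle A (length I) x = word_product A I"
proof
  \<comment> \<open>Positions outside the word are filled with the symbol \<open>1\<close>, which
    exists because \<open>k \<ge> 1\<close>.\<close>
  let ?x = "\<lambda>l. if l \<ge> 0 \<and> nat l < length I then I ! nat l else (1 :: nat)"
  show "?x \<in> Sigma_space k"
    using I k by (auto simp: Sigma_space_def words_def in_lists_conv_set)
  have "map (\<lambda>i. ?x (int i)) [0..<length I] = I" by (intro nth_equalityI) auto
  then show "cocycle A (length I) ?x = word_product A I" by (simp add: cocycle_eq_word_product)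
qed

text \<open>Without symbols only the empty word remains, and its product, the identity, cannot move
  a line \<open>G\<close> out of \<open>{G}\<close>.\<close>

lemma twisting_imp_nonempty:
  assumes "twisting k A" shows "k \<ge> 1"
proof (rule ccontr)
  assume "\<not> ?thesis"
  then have "words k = {[]}" by (auto simp: words_def)
  moreover have L: "span {vector [1, 0] :: real^2} \<in> lines"
    by (rule span_singleton_in_lines) (simp add: vec2_eq_iff)
  ultimately show False
    using assms unfolding twisting_def
    by (metis L empty_subsetI finite.emptyI finite.insertI image_cong image_ident insert_subset
        matrix_vector_mul_lid singletonD singletonI word_product.simps(1))
qed

section \<open>The extremal norm\<close>

lemma cocycle_norm_bound:
  obtains M where "M \<ge> 1" "\<And>n x. x \<in> Sigma_space k \<Longrightarrow> op_norm (cocycle A n x) \<le> M ^ n"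
proof -
  \<comment> \<open>Inserting \<open>1\<close> keeps the set nonempty when \<open>k = 0\<close> and
    gives \<open>M \<ge> 1\<close>.\<close>
  define M where "M = Max (insert 1 ((\<lambda>i. op_norm (A i)) ` {1..k}))"
  have M: "op_norm (A i) \<le> M" if "i \<in> {1..k}" for i
    unfolding M_def by (rule Max_ge) (use that in auto)
  have M1: "M \<ge> 1" unfolding M_def by (rule Max_ge) auto
  have "op_norm (cocycle A n x) \<le> M ^ n" if x: "x \<in> Sigma_space k" for n x
  proof (induction n)
    case (Suc n)
    have "op_norm (cocycle A (Suc n) x) \<le> op_norm (A (x (int n))) * op_norm (cocycle A n x)"
      using op_norm_mult_le by simp
    also have "\<dots> \<le> M * M ^ n"
      using M[of "x (int n)"] x Suc M1 by (intro mult_mono op_norm_nonneg) (auto simp: Sigma_space_def)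
    finally show ?case by simp
  next
    case 0
    have "op_norm (cocycle A 0 x) = 1" using op_norm_mat_1 by (simp only: cocycle.simps)
    then show ?case by (simp only: power_0 order_refl)
  qed
  with M1 show thesis by (rule that)
qed

lemma bdd_above_cocycle_norm: "bdd_above ((\<lambda>x. op_norm (cocycle A n x)) ` Sigma_space k)"
  by (rule cocycle_norm_bound[of k A]) (auto intro!: bdd_aboveI)

lemma det_word_product:
  "\<forall>i\<in>{1..k}. det (A i) = 1 \<Longrightarrow> I \<in> words k \<Longrightarrow> det (word_product A I) = 1"
  by (induction I) (auto simp: words_def det_mul)

lemma det_cocycle:
  "\<forall>i\<in>{1..k}. det (A i) = 1 \<Longrightarrow> x \<in> Sigma_space k \<Longrightarrow> det (cocycle A n x) = 1"
  by (induction n) (auto simp: Sigma_space_def det_mul)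

lemma left_shift_funpow_Sigma_space: "x \<in> Sigma_space k \<Longrightarrow> (left_shift ^^ n) x \<in> Sigma_space k"
  by (induction n) (auto simp: Sigma_space_def left_shift_def)

text \<open>The suprema are submultiplicative, so Fekete's lemma applies to their logarithms and the
  \<open>lim\<close> in the definition is a genuine limit.\<close>

lemma max_lyapunov_exponent_tendsto:
  assumes SL2: "\<forall>i\<in>{1..k}. det (A i) = 1" and k: "k \<ge> 1"
  shows "(\<lambda>n. ln (SUP x\<in>Sigma_space k. op_norm (cocycle A n x)) / real n)
    \<longlonglongrightarrow> max_lyapunov_exponent k A"
proof -
  define s where "s n = (SUP x\<in>Sigma_space k. op_norm (cocycle A n x))" for n
  have ne: "Sigma_space k \<noteq> {}"
    using k by (auto simp: Sigma_space_def intro!: exI[of _ "\<lambda>_. 1"])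
  have up: "op_norm (cocycle A n x) \<le> s n" if "x \<in> Sigma_space k" for n x
    unfolding s_def by (rule cSUP_upper[OF that bdd_above_cocycle_norm])
  have s1: "s n \<ge> 1" for n
  proof -
    obtain x where x: "x \<in> Sigma_space k" using ne by blast
    have "1 \<le> op_norm (cocycle A n x)" by (rule op_norm_ge_1[OF det_cocycle[OF SL2 x]])
    then show ?thesis using up[OF x, of n] by simp
  qed
  have "s (m + n) \<le> s m * s n" for m n
    unfolding s_def[of "m + n"]
  proof (rule cSUP_least[OF ne])
    fix x assume x: "x \<in> Sigma_space k"
    have "op_norm (cocycle A (m + n) x)
        \<le> op_norm (cocycle A m ((left_shift ^^ n) x)) * op_norm (cocycle A n x)"
      unfolding cocycle_add by (rule op_norm_mult_le)
    also have "\<dots> \<le> s m * s n"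
      using s1[of m] by (intro mult_mono up op_norm_nonneg left_shift_funpow_Sigma_space x) auto
    finally show "op_norm (cocycle A (m + n) x) \<le> s m * s n" .
  qed
  then have sub: "ln (s (m + n)) \<le> ln (s m) + ln (s n)" for m n
    using s1[of "m + n"] s1[of m] s1[of n]
    by (metis ln_mono ln_mult_pos less_le_trans zero_less_one)
  obtain L where L: "(\<lambda>n. ln (s n) / real n) \<longlonglongrightarrow> L"
  proof (rule subadditive_tendsto_Inf[of "\<lambda>n. ln (s n)"])
    show "0 \<le> ln (s n)" for n using s1 by simp
  qed (use sub in auto)
  moreover have "max_lyapunov_exponent k A = L"
    unfolding max_lyapunov_exponent_def s_def[symmetric] using limI[OF L] by simp
  ultimately show ?thesis by (simp add: s_def)
qed

text \<open>Concatenating such words doubles the discounted norm \<open>j\<close> times within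
  length \<open>j * l\<close>. This is a growth rate of at least \<open>\<beta> + ln 2 / l\<close>
  along arbitrarily long words, more than the maximal exponent allows.\<close>

lemma iterated_expansion_absurd:
  fixes k A
  defines "\<beta> \<equiv> max_lyapunov_exponent k A"
  assumes SL2: "\<forall>i\<in>{1..k}. det (A i) = 1" and k: "k \<ge> 1"
    and expand: "\<And>v. v \<noteq> 0 \<Longrightarrow> \<exists>I\<in>words k. 1 \<le> length I \<and> length I \<le> l \<and>
      2 * norm v \<le> exp (- \<beta> * real (length I)) * norm (word_product A I *v v)"
  shows False
proof -
  define s where "s n = (SUP x\<in>Sigma_space k. op_norm (cocycle A n x))" for n
  have iter: "\<exists>I\<in>words k. j \<le> length I \<and> length I \<le> j * l \<and>
      2 ^ j * norm v \<le> exp (- \<beta> * real (length I)) * norm (word_product A I *v v)"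
    if "v \<noteq> 0" for v :: "real^2" and j
  proof (induction j)
    case 0
    then show ?case by (intro bexI[of _ "[]"]) (auto simp: words_def)
  next
    case (Suc j)
    then obtain I where I: "I \<in> words k" "j \<le> length I" "length I \<le> j * l"
      "2 ^ j * norm v \<le> exp (- \<beta> * real (length I)) * norm (word_product A I *v v)" by blast
    let ?w = "word_product A I *v v"
    have "?w \<noteq> 0" by (rule matrix_vector_mult_neq_0[OF det_word_product[OF SL2 I(1)] that])
    from expand[OF this] obtain J where J: "J \<in> words k" "1 \<le> length J" "length J \<le> l"
      "2 * norm ?w \<le> exp (- \<beta> * real (length J)) * norm (word_product A J *v ?w)" by blast
    have "2 ^ Suc j * norm v \<le> exp (- \<beta> * real (length I)) * (2 * norm ?w)"
      using I(4) by simp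
    also have "\<dots> \<le> exp (- \<beta> * real (length I)) * (exp (- \<beta> * real (length J)) * norm (word_product A J *v ?w))"
      using J(4) by (intro mult_left_mono) auto
    also have "\<dots> = exp (- \<beta> * real (length (I @ J))) * norm (word_product A (I @ J) *v v)"
      by (simp add: word_product_append matrix_vector_mul_assoc exp_add[symmetric] algebra_simps)
    finally show ?case using I J by (intro bexI[of _ "I @ J"]) (auto simp: words_def)
  qed
  let ?v = "vector [1, 0] :: real^2"
  have v: "?v \<noteq> 0" "norm ?v = 1" by (simp_all add: vec2_eq_iff norm_vec_def L2_set_def sum_2)
  have l: "l \<ge> 1" using expand[OF v(1)] by auto
  have "(\<lambda>n. ln (s n) / real n) \<longlonglongrightarrow> \<beta>"
    using max_lyapunov_exponent_tendsto[OF SL2 k] by (simp add: s_def \<beta>_def)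
  moreover have "\<beta> < \<beta> + ln 2 / real l" using l by simp
  ultimately have "eventually (\<lambda>n. ln (s n) / real n < \<beta> + ln 2 / real l) sequentially"
    by (rule order_tendstoD)
  then obtain j where j: "\<And>n. n \<ge> j \<Longrightarrow> ln (s n) / real n < \<beta> + ln 2 / real l"
    by (auto simp: eventually_sequentially)
  \<comment> \<open>Using \<open>Suc j\<close> words makes the length \<open>n\<close> positive as
    well as at least \<open>j\<close>.\<close>
  obtain I where I: "I \<in> words k" "Suc j \<le> length I" "length I \<le> Suc j * l"
    "2 ^ Suc j * norm ?v \<le> exp (- \<beta> * real (length I)) * norm (word_product A I *v ?v)"
    using iter[OF v(1)] by blast
  define n where "n = length I"
  have n: "n \<ge> j" "n > 0" using I(2) by (auto simp: n_def)
  obtain x where x: "x \<in> Sigma_space k" "cocycle A n x = word_product A I"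
    using words_obtain_point[OF I(1) k] n_def by metis
  have "norm (word_product A I *v ?v) \<le> op_norm (word_product A I)"
    using norm_le_op_norm[of "word_product A I" ?v] v by simp
  also have "\<dots> \<le> s n"
    unfolding s_def x(2)[symmetric] by (rule cSUP_upper[OF x(1) bdd_above_cocycle_norm])
  finally have "exp (- \<beta> * real n) * norm (word_product A I *v ?v) \<le> exp (- \<beta> * real n) * s n"
    by (intro mult_left_mono) auto
  then have "2 ^ Suc j \<le> exp (- \<beta> * real n) * s n"
    using I(4) unfolding n_def v(2) by linarith
  then have e: "2 ^ Suc j * exp (\<beta> * real n) \<le> s n"
    by (simp add: exp_minus field_simps)
  then have "ln (2 ^ Suc j * exp (\<beta> * real n)) \<le> ln (s n)"
    by (intro ln_mono) auto
  then have "real (Suc j) * ln 2 + \<beta> * real n \<le> ln (s n)"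
    by (subst (asm) ln_mult_pos) (auto simp: ln_realpow simp del: power_Suc)
  moreover have "real n * ln 2 / real l \<le> real (Suc j) * ln 2"
  proof -
    have "real n \<le> real (Suc j) * real l" using I(3) unfolding n_def by (metis of_nat_le_iff of_nat_mult)
    then have "real n / real l \<le> real (Suc j)" using l by (simp add: field_simps)
    then have "real n / real l * ln 2 \<le> real (Suc j) * ln 2" by (intro mult_right_mono) auto
    then show ?thesis by simp
  qed
  ultimately have "real n * (\<beta> + ln 2 / real l) \<le> ln (s n)" by (simp add: algebra_simps)
  then have "\<beta> + ln 2 / real l \<le> ln (s n) / real n" using n by (simp add: field_simps)
  then show False using j[OF n(1)] by simp
qed

text \<open>\<open>N v\<close> is the supremum, over all words, of the norm of the image of
  \<open>v\<close> discounted by \<open>exp (- \<beta>)\<close> per letter; prepending a letter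
  yields the last property. The issue is finiteness: the vectors with bounded discounted images form
  an invariant subspace \<open>V\<close>, which is nonzero by
  \<open>iterated_expansion_absurd\<close> and not a line by twisting.\<close>

lemma extremal_norm_exists:
  fixes k A
  defines "\<beta> \<equiv> max_lyapunov_exponent k A"
  assumes SL2: "\<forall>i\<in>{1..k}. det (A i) = 1" and tw: "twisting k A"
  obtains N :: "real^2 \<Rightarrow> real" and C :: real where
    "\<And>v. norm v \<le> N v" "\<And>v. N v \<le> C * norm v" "\<And>u v. N (u + v) \<le> N u + N v"
    "\<And>t v. N (t *\<^sub>R v) = \<bar>t\<bar> * N v" "\<And>i v. i \<in> {1..k} \<Longrightarrow> N (A i *v v) \<le> exp \<beta> * N v"
proof -
  have k: "k \<ge> 1" by (rule twisting_imp_nonempty[OF tw])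
  define g where "g I v = exp (- \<beta> * real (length I)) * norm (word_product A I *v v)" for I v
  define V where "V = {v. bdd_above ((\<lambda>I. g I v) ` words k)}"
  have g0: "0 \<le> g I v" for I v by (simp add: g_def)
  have g_add: "g I (u + v) \<le> g I u + g I v" for I u v
    unfolding g_def
    by (simp add: matrix_vector_right_distrib distrib_left[symmetric] norm_triangle_ineq)
  have g_scale: "g I (t *\<^sub>R v) = \<bar>t\<bar> * g I v" for I t v
    by (simp add: g_def matrix_vector_mult_scaleR)
  \<comment> \<open>The letter \<open>i\<close> acts first, and \<open>word_product\<close> keeps
    the first factor at the head of the word.\<close>
  have g_step: "g I (A i *v v) = exp \<beta> * g (i # I) v" for I i v
    by (simp add: g_def matrix_vector_mul_assoc exp_add[symmetric] algebra_simps)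
  have V_iff: "v \<in> V \<longleftrightarrow> (\<exists>c. \<forall>I\<in>words k. g I v \<le> c)" for v
    by (auto simp: V_def bdd_above_def)
  have V_add: "u + v \<in> V" if uv: "u \<in> V" "v \<in> V" for u v
  proof -
    from uv obtain c d where "\<forall>I\<in>words k. g I u \<le> c" "\<forall>I\<in>words k. g I v \<le> d"
      unfolding V_iff by blast
    then have "\<forall>I\<in>words k. g I (u + v) \<le> c + d" using g_add by (smt (verit))
    then show ?thesis unfolding V_iff by blast
  qed
  have V_scale: "t *\<^sub>R v \<in> V" if v: "v \<in> V" for t v
  proof -
    from v obtain c where "\<forall>I\<in>words k. g I v \<le> c" unfolding V_iff by blast
    then have "\<forall>I\<in>words k. g I (t *\<^sub>R v) \<le> \<bar>t\<bar> * c" by (auto simp: g_scale mult_left_mono)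
    then show ?thesis unfolding V_iff by blast
  qed
  have V_step: "A i *v v \<in> V" if i: "i \<in> {1..k}" and v: "v \<in> V" for i v
  proof -
    from v obtain c where c: "\<forall>I\<in>words k. g I v \<le> c" unfolding V_iff by blast
    have "g I (A i *v v) \<le> exp \<beta> * c" if "I \<in> words k" for I
    proof -
      have "i # I \<in> words k" using i that by (simp add: words_def)
      then show ?thesis using c by (simp add: g_step)
    qed
    then show ?thesis unfolding V_iff by blast
  qed
  have V_word: "word_product A I *v v \<in> V" if "I \<in> words k" "v \<in> V" for I v
    using that
  proof (induction I arbitrary: v)
    case (Cons i I)
    then have "i \<in> {1..k}" "I \<in> words k" by (auto simp: words_def)
    then have "word_product A I *v (A i *v v) \<in> V" using Cons V_step by blast
    then show ?case by (simp add: matrix_vector_mul_assoc)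
  qed simp
  \<comment> \<open>If \<open>V\<close> were zero, each unit vector would be more than doubled by
    some word. By compactness of the circle finitely many words suffice, which bounds their
    lengths.\<close>
  have "\<exists>v0\<in>V. v0 \<noteq> 0"
  proof (rule ccontr)
    assume n: "\<not> ?thesis"
    have "\<exists>I\<in>words k. g I v > 2" if "v \<in> sphere 0 1" for v
    proof -
      have "v \<notin> V" using n that by auto
      then show ?thesis unfolding V_iff by (metis not_less)
    qed
    then have cov: "sphere 0 1 \<subseteq> (\<Union>I\<in>words k. {v. g I v > 2})" by blast
    have op: "open {v. g I v > 2}" for I
    proof -
      have "continuous_on UNIV (\<lambda>v. g I v)" unfolding g_def
        by (intro continuous_intros matrix_vector_mult_linear_continuous_on)
      then show ?thesis by (intro open_Collect_less continuous_intros) auto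
    qed
    obtain W where W: "W \<subseteq> words k" "finite W" "sphere 0 1 \<subseteq> (\<Union>I\<in>W. {v. g I v > 2})"
      using compactE_image[OF compact_sphere, of "words k" "\<lambda>I. {v. g I v > 2}" "0 :: real^2" 1] op cov
      by metis
    show False
    proof (rule iterated_expansion_absurd[OF SL2 k, of "Max (length ` W)"])
      fix v :: "real^2" assume v: "v \<noteq> 0"
      then have "(1 / norm v) *\<^sub>R v \<in> sphere 0 1" by simp
      then obtain I where I: "I \<in> W" "g I ((1 / norm v) *\<^sub>R v) > 2" using W(3) by blast
      then have gI: "g I v > 2 * norm v" using v by (simp add: g_scale field_simps)
      have "I \<noteq> []" using gI v by (auto simp: g_def)
      then show "\<exists>I\<in>words k. 1 \<le> length I \<and> length I \<le> Max (length ` W) \<and>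
        2 * norm v \<le> exp (- max_lyapunov_exponent k A * real (length I)) * norm (word_product A I *v v)"
        using gI I(1) W(1,2)
        by (intro bexI[of _ I]) (auto simp: g_def \<beta>_def Suc_le_eq intro!: Max_ge)
    qed
  qed
  then obtain v0 where v0: "v0 \<in> V" "v0 \<noteq> 0" by blast
  \<comment> \<open>Twisting is used with the single forbidden line \<open>V\<close>.\<close>
  have "V \<noteq> span {v0}"
  proof
    assume eq: "V = span {v0}"
    have L: "V \<in> lines" unfolding eq by (rule span_singleton_in_lines[OF v0(2)])
    have "(*v) (word_product A J) ` V = V" if J: "J \<in> words k" for J
    proof
      show "(*v) (word_product A J) ` V \<subseteq> V" using V_word[OF J] by blast
      show "V \<subseteq> (*v) (word_product A J) ` V"
      proof
        fix w assume w: "w \<in> V"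
        have "word_product A J *v v0 \<noteq> 0"
          by (rule matrix_vector_mult_neq_0[OF det_word_product[OF SL2 J] v0(2)])
        then have "V = span {word_product A J *v v0}"
          by (rule lines_eq_span[OF L V_word[OF J v0(1)]])
        then obtain t where "w = t *\<^sub>R (word_product A J *v v0)" using w by (auto simp: span_singleton)
        then have "w = word_product A J *v (t *\<^sub>R v0)" by (simp add: matrix_vector_mult_scaleR)
        then show "w \<in> (*v) (word_product A J) ` V" using V_scale[OF v0(1)] by blast
      qed
    qed
    moreover have "\<exists>J\<in>words k. (*v) (word_product A J) ` V \<notin> {V}"
      using tw[unfolded twisting_def, rule_format, OF L, of "{V}"] L by blast
    ultimately show False by blast
  qed
  moreover have "span {v0} \<subseteq> V" using V_scale[OF v0(1)] by (auto simp: span_singleton)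
  ultimately obtain w0 where w0: "w0 \<in> V" "w0 \<notin> span {v0}" by blast
  then have wd: "wedge v0 w0 \<noteq> 0" using wedge_eq_0_iff[OF v0(2)] by blast
  have "v \<in> V" for v
    by (subst wedge_decompose[OF wd, of v]) (intro V_add V_scale v0(1) w0(1))
  then have bdd: "bdd_above ((\<lambda>I. g I v) ` words k)" for v by (simp add: V_def)
  define N where "N v = (SUP I\<in>words k. g I v)" for v
  have nil: "[] \<in> words k" by (simp add: words_def)
  have up: "g I v \<le> N v" if "I \<in> words k" for I v
    unfolding N_def by (rule cSUP_upper[OF that bdd])
  have least: "N v \<le> c" if "\<And>I. I \<in> words k \<Longrightarrow> g I v \<le> c" for v c
    unfolding N_def by (rule cSUP_least) (use that nil in auto)
  have N_norm: "norm v \<le> N v" for v using up[OF nil, of v] by (simp add: g_def)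
  have N_add: "N (u + v) \<le> N u + N v" for u v
    by (rule least) (rule order_trans[OF g_add add_mono[OF up up]])
  have N_le: "N (t *\<^sub>R v) \<le> \<bar>t\<bar> * N v" for t v
    by (rule least) (simp add: g_scale mult_left_mono up)
  have N_scale: "N (t *\<^sub>R v) = \<bar>t\<bar> * N v" for t v
  proof (cases "t = 0")
    case True
    have "N 0 \<le> 0" by (rule least) (simp add: g_def)
    then show ?thesis using True N_norm[of 0] by simp
  next
    case False
    have "N ((1 / t) *\<^sub>R (t *\<^sub>R v)) \<le> \<bar>1 / t\<bar> * N (t *\<^sub>R v)" by (rule N_le)
    then have "\<bar>t\<bar> * N v \<le> N (t *\<^sub>R v)" using False by (simp add: field_simps)
    then show ?thesis using N_le[of t v] by simp
  qed
  have N_step: "N (A i *v v) \<le> exp \<beta> * N v" if "i \<in> {1..k}" for i v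
    by (rule least) (use that in \<open>auto simp: g_step words_def intro!: up\<close>)
  define C where "C = N (axis 1 1) + N (axis 2 1)"
  have "N v \<le> C * norm v" for v
  proof -
    have v: "v = v $ 1 *\<^sub>R axis 1 1 + v $ 2 *\<^sub>R axis 2 1"
      by (simp add: vec2_eq_iff axis_def)
    have "N v \<le> N (v $ 1 *\<^sub>R axis 1 1) + N (v $ 2 *\<^sub>R axis 2 1)" by (subst v) (rule N_add)
    also have "\<dots> = \<bar>v $ 1\<bar> * N (axis 1 1) + \<bar>v $ 2\<bar> * N (axis 2 1)" by (simp add: N_scale)
    also have "\<dots> \<le> norm v * N (axis 1 1) + norm v * N (axis 2 1)"
      by (intro add_mono mult_right_mono component_le_norm_cart order_trans[OF norm_ge_zero N_norm])
    finally show ?thesis by (simp add: C_def algebra_simps)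
  qed
  then show thesis using that[of N C] N_norm N_add N_scale N_step by blast
qed

section \<open>Entropy of partitions via finite codes\<close>

context information_space
begin

lemma entropy_simple_function:
  assumes "simple_function M X"
  shows "\<H>(X) = - (\<Sum>c\<in>X ` space M. prob (X -` {c} \<inter> space M) * log b (prob (X -` {c} \<inter> space M)))"
  by (rule entropy_simple_distributed[OF simple_distributedI[OF assms measure_nonneg refl]])

lemma entropy_simple_superset:
  assumes X: "simple_function M X" and F: "finite F" "X ` space M \<subseteq> F"
  shows "\<H>(X) = - (\<Sum>c\<in>F. prob (X -` {c} \<inter> space M) * log b (prob (X -` {c} \<inter> space M)))"
proof -
  have "X -` {c} \<inter> space M = {}" if "c \<in> F - X ` space M" for c
    using that by auto
  then show ?thesis
    unfolding entropy_simple_function[OF X]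
    by (intro arg_cong[where f=uminus] sum.mono_neutral_left F) auto
qed

text \<open>On \<open>space M\<close> the function \<open>X\<close> factors through
  \<open>V\<close>, by a choice of representatives, so data processing applies.\<close>

lemma entropy_mono_determined:
  assumes X: "simple_function M X" and V: "simple_function M V"
    and det: "\<And>x y. x \<in> space M \<Longrightarrow> y \<in> space M \<Longrightarrow> V x = V y \<Longrightarrow> X x = X y"
  shows "\<H>(X) \<le> \<H>(V)"
proof -
  define f where "f v = X (SOME x. x \<in> space M \<and> V x = v)" for v
  have eq: "(f \<circ> V) x = X x" if "x \<in> space M" for x
  proof -
    have "(SOME y. y \<in> space M \<and> V y = V x) \<in> space M \<and> V (SOME y. y \<in> space M \<and> V y = V x) = V x"
      by (rule someI[of _ x]) (use that in simp)
    then show ?thesis unfolding f_def comp_def using that by (intro det) auto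
  qed
  have sf: "simple_function M (f \<circ> V)" by (rule simple_function_compose[OF V])
  have img: "(f \<circ> V) ` space M = X ` space M" by (rule image_cong[OF refl eq])
  have pre: "(f \<circ> V) -` {c} \<inter> space M = X -` {c} \<inter> space M" for c using eq by auto
  have "\<H>(X) = \<H>(f \<circ> V)"
    using entropy_simple_function[OF X] entropy_simple_function[OF sf] by (simp only: img pre)
  also have "\<dots> \<le> \<H>(V)" by (rule entropy_data_processing[OF V])
  finally show ?thesis .
qed

lemma entropy_Pair_le:
  assumes X: "simple_function M X" and Y: "simple_function M Y"
  shows "\<H>(\<lambda>x. (X x, Y x)) \<le> \<H>(X) + \<H>(Y)"
  using entropy_chain_rule[OF X Y] conditional_entropy_less_eq_entropy[OF Y X] by simp

lemma entropy_measure_preserving: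
  assumes X: "simple_function M X" and T: "T \<in> measurable M M" "distr M M T = M"
  shows "simple_function M (X \<circ> T)" "\<H>(X \<circ> T) = \<H>(X)"
proof -
  have sp: "T x \<in> space M" if "x \<in> space M" for x using T(1) that by (rule measurable_space)
  have pre: "(X \<circ> T) -` S \<inter> space M = T -` (X -` S \<inter> space M) \<inter> space M" for S
    using sp by auto
  have "(X \<circ> T) ` space M \<subseteq> X ` space M" using sp by auto
  then show sf: "simple_function M (X \<circ> T)"
    unfolding simple_function_def pre
    using X finite_subset simple_functionD[OF X]
    by (blast intro: measurable_sets[OF T(1)])
  have "prob ((X \<circ> T) -` {c} \<inter> space M) = prob (X -` {c} \<inter> space M)" for c
  proof -
    have s: "X -` {c} \<inter> space M \<in> sets M" using X by (rule simple_functionD)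
    have "measure (distr M M T) (X -` {c} \<inter> space M) = prob ((X \<circ> T) -` {c} \<inter> space M)"
      unfolding pre by (rule measure_distr[OF T(1) s])
    then show ?thesis by (simp add: T(2))
  qed
  then show "\<H>(X \<circ> T) = \<H>(X)"
    using entropy_simple_superset[OF sf simple_functionD(1)[OF X] \<open>(X \<circ> T) ` space M \<subseteq> X ` space M\<close>]
      entropy_simple_function[OF X] by simp
qed

lemma measure_preserving_funpow:
  assumes T: "T \<in> measurable M M" "distr M M T = M"
  shows "T ^^ n \<in> measurable M M \<and> distr M M (T ^^ n) = M"
proof (induction n)
  case (Suc n)
  then have "distr M M (T \<circ> T ^^ n) = distr (distr M M (T ^^ n)) M T"
    by (subst distr_distr) (use T in auto)
  moreover have "T \<circ> T ^^ n \<in> measurable M M" using Suc T by (blast intro: measurable_comp)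
  moreover have "T ^^ Suc n = T \<circ> T ^^ n" by simp
  ultimately show ?case using Suc T by metis
qed (simp add: id_def)

text \<open>Each further report costs at most \<open>\<H>(D)\<close>, because the iterates preserve
  the measure and entropy is subadditive.\<close>

lemma entropy_iterates_le:
  assumes W: "simple_function M W" and D: "simple_function M D"
    and T: "T \<in> measurable M M" "distr M M T = M"
  defines "V \<equiv> \<lambda>n x. (W x, map (\<lambda>i. D ((T ^^ i) x)) [0..<n])"
  shows "simple_function M (V n) \<and> \<H>(V n) \<le> \<H>(W) + real n * \<H>(D)"
proof (induction n)
  case 0
  have "simple_function M (V 0)" "\<H>(V 0) \<le> \<H>(W)"
    using simple_function_compose[OF W, of "\<lambda>w. (w, [])"] entropy_data_processing[OF W, of "\<lambda>w. (w, [])"]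
    by (simp_all add: V_def comp_def)
  then show ?case by simp
next
  case (Suc n)
  have Dn: "simple_function M (D \<circ> (T ^^ n))" "\<H>(D \<circ> (T ^^ n)) = \<H>(D)"
    using entropy_measure_preserving[OF D] measure_preserving_funpow[OF T, of n] by blast+
  let ?Y = "\<lambda>x. (V n x, (D \<circ> (T ^^ n)) x)"
  let ?g = "\<lambda>((w, l), d). (w, l @ [d])"
  have Y: "simple_function M ?Y" using simple_function_Pair[of M "V n" "D \<circ> T ^^ n"] Suc Dn(1) by blast
  have eq: "V (Suc n) = ?g \<circ> ?Y" by (auto simp: V_def fun_eq_iff)
  have "\<H>(V (Suc n)) \<le> \<H>(?Y)" unfolding eq by (rule entropy_data_processing[OF Y])
  also have "\<dots> \<le> \<H>(V n) + \<H>(D \<circ> (T ^^ n))" by (rule entropy_Pair_le) (use Suc Dn(1) in blast)+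
  also have "\<dots> \<le> \<H>(W) + real (Suc n) * \<H>(D)" using Suc Dn by (simp add: algebra_simps)
  finally have "\<H>(V (Suc n)) \<le> \<H>(W) + real (Suc n) * \<H>(D)" .
  moreover have "simple_function M (V (Suc n))"
    unfolding eq by (rule simple_function_compose[OF Y])
  ultimately show ?case by blast
qed

end

section \<open>Finite partitions as random variables\<close>

definition partition_cell :: "'a set set \<Rightarrow> 'a \<Rightarrow> 'a set" where
  "partition_cell Q x = (THE C. C \<in> Q \<and> x \<in> C)"

lemma partition_cell_eq:
  assumes "partition_on S Q" "C \<in> Q" "x \<in> C"
  shows "partition_cell Q x = C"
  unfolding partition_cell_def
proof (rule the_equality)
  show "D = C" if "D \<in> Q \<and> x \<in> D" for D
    using disjointD[OF partition_onD2[OF assms(1)], of D C] that assms by blast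
qed (use assms in blast)

lemma partition_cell_mem:
  assumes "partition_on S Q" "x \<in> S"
  shows "partition_cell Q x \<in> Q" "x \<in> partition_cell Q x"
proof -
  obtain C where "C \<in> Q" "x \<in> C" using assms by (auto simp: partition_on_def)
  then show "partition_cell Q x \<in> Q" "x \<in> partition_cell Q x"
    using partition_cell_eq[OF assms(1)] by auto
qed

lemma partition_cell_image:
  assumes "partition_on S Q" shows "partition_cell Q ` S = Q"
proof
  show "Q \<subseteq> partition_cell Q ` S"
  proof
    fix C assume C: "C \<in> Q"
    have "C \<noteq> {}" "C \<subseteq> S" using assms C by (auto simp: partition_on_def)
    then obtain x where x: "x \<in> C" "x \<in> S" by blast
    with partition_cell_eq[OF assms C x(1)] show "C \<in> partition_cell Q ` S" by blast
  qed
qed (use partition_cell_mem[OF assms] in blast)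

lemma partition_cell_vimage:
  assumes "partition_on S Q" "C \<in> Q" shows "partition_cell Q -` {C} \<inter> S = C"
proof -
  have "C \<subseteq> S" using assms by (auto simp: partition_on_def)
  moreover have "x \<in> C" if "x \<in> S" "partition_cell Q x = C" for x
    using partition_cell_mem(2)[OF assms(1) that(1)] that(2) by simp
  ultimately show ?thesis
    using partition_cell_eq[OF assms] by blast
qed

lemma simple_function_partition_cell:
  assumes "finite_measurable_partition M Q"
  shows "simple_function M (partition_cell Q)"
proof -
  have p: "partition_on (space M) Q" "finite Q" "Q \<subseteq> sets M"
    using assms by (auto simp: finite_measurable_partition_def)
  show ?thesis
    unfolding simple_function_def partition_cell_image[OF p(1)]
    using p partition_cell_vimage[OF p(1)] by auto
qed

text \<open>Each cell serves as its own label, and the base \<open>exp 1\<close> turns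
  \<open>log\<close> into the natural logarithm of \<open>partition_entropy\<close>.\<close>

lemma partition_entropy_eq_entropy:
  assumes "prob_space M" and Q: "finite_measurable_partition M Q"
  shows "partition_entropy M Q =
    prob_space.entropy M (exp 1) (count_space (partition_cell Q ` space M)) (partition_cell Q)"
proof -
  interpret prob_space M by fact
  interpret information_space M "exp 1" by unfold_locales simp
  have p: "partition_on (space M) Q" "finite Q" "Q \<subseteq> sets M"
    using assms by (auto simp: finite_measurable_partition_def)
  show ?thesis
    using entropy_simple_function[OF simple_function_partition_cell[OF Q]]
    by (simp add: partition_entropy_def partition_cell_image[OF p(1)] partition_cell_vimage[OF p(1)] log_def)
qed

lemma finite_measurable_partition_iterated_join:
  assumes M: "space M \<noteq> {}" and T: "T \<in> measurable M M" and P: "finite_measurable_partition M P"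
  shows "finite_measurable_partition M (iterated_join M T P n)"
proof (induction n)
  case 0
  then show ?case using M by (auto simp: finite_measurable_partition_def partition_on_def)
next
  case (Suc n)
  let ?Q = "iterated_join M T P n"
  let ?R = "iterated_join M T P (Suc n)"
  have Tn: "T ^^ n \<in> measurable M M"
    using T by (rule measurable_compose_n)
  have p: "partition_on (space M) P" "finite P" "P \<subseteq> sets M"
    and q: "partition_on (space M) ?Q" "finite ?Q" "?Q \<subseteq> sets M"
    using P Suc by (auto simp: finite_measurable_partition_def)
  have "?R \<subseteq> (\<lambda>(C, D). C \<inter> ((T ^^ n) -` D \<inter> space M)) ` (?Q \<times> P)" by auto
  then have "finite ?R" by (rule finite_subset) (use p q in auto)
  moreover have "?R \<subseteq> sets M"
  proof
    fix E assume "E \<in> ?R"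
    then obtain C D where E: "E = C \<inter> ((T ^^ n) -` D \<inter> space M)" "C \<in> ?Q" "D \<in> P" by auto
    then have "C \<in> sets M" "D \<in> sets M" using p(3) q(3) by auto
    then show "E \<in> sets M" unfolding E(1) by (intro sets.Int measurable_sets[OF Tn])
  qed
  moreover have "partition_on (space M) ?R"
    unfolding partition_on_def
  proof (intro conjI)
    show "\<Union> ?R = space M"
    proof
      show "\<Union> ?R \<subseteq> space M" by auto
      show "space M \<subseteq> \<Union> ?R"
      proof
        fix x assume x: "x \<in> space M"
        have "x \<in> partition_cell ?Q x" "partition_cell ?Q x \<in> ?Q"
          using partition_cell_mem[OF q(1) x] by auto
        moreover have "(T ^^ n) x \<in> space M" using Tn x by (rule measurable_space)
        then have "(T ^^ n) x \<in> partition_cell P ((T ^^ n) x)" "partition_cell P ((T ^^ n) x) \<in> P"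
          using partition_cell_mem[OF p(1)] by auto
        moreover define E where
          "E = partition_cell ?Q x \<inter> ((T ^^ n) -` partition_cell P ((T ^^ n) x) \<inter> space M)"
        ultimately have "x \<in> E" "E \<in> ?R" using x by auto
        then show "x \<in> \<Union> ?R" by blast
      qed
    qed
    show "disjoint ?R"
    proof (rule disjointI)
      fix E1 E2 assume E: "E1 \<in> ?R" "E2 \<in> ?R" "E1 \<noteq> E2"
      from E(1) obtain C D where 1: "E1 = C \<inter> ((T ^^ n) -` D \<inter> space M)" "C \<in> ?Q" "D \<in> P" by auto
      from E(2) obtain C' D' where 2: "E2 = C' \<inter> ((T ^^ n) -` D' \<inter> space M)" "C' \<in> ?Q" "D' \<in> P"
        by auto
      have "C \<noteq> C' \<or> D \<noteq> D'" using E(3) 1 2 by auto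
      then have "C \<inter> C' = {} \<or> D \<inter> D' = {}"
        using disjointD[OF partition_onD2[OF p(1)] 1(3) 2(3)]
          disjointD[OF partition_onD2[OF q(1)] 1(2) 2(2)] by blast
      then show "E1 \<inter> E2 = {}" unfolding 1(1) 2(1) by blast
    qed
    show "{} \<notin> ?R" by simp
  qed
  ultimately show ?case by (simp add: finite_measurable_partition_def)
qed

text \<open>A cell of the join fixes the itinerary through \<open>P\<close> for \<open>n\<close>
  steps and nothing else.\<close>

lemma iterated_join_cell_eqI:
  assumes M: "space M \<noteq> {}" and T: "T \<in> measurable M M" and P: "finite_measurable_partition M P"
    and xy: "x \<in> space M" "y \<in> space M"
    and eq: "\<And>i. i < n \<Longrightarrow> partition_cell P ((T ^^ i) x) = partition_cell P ((T ^^ i) y)"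
  shows "partition_cell (iterated_join M T P n) x = partition_cell (iterated_join M T P n) y"
proof -
  have p: "partition_on (space M) P" using P by (auto simp: finite_measurable_partition_def)
  have "y \<in> C" if "C \<in> iterated_join M T P n" "x \<in> C" for C
    using that eq
  proof (induction n arbitrary: C)
    case (Suc n)
    from Suc.prems(1) obtain C' D
      where C: "C = C' \<inter> ((T ^^ n) -` D \<inter> space M)" "C' \<in> iterated_join M T P n" "D \<in> P"
      by auto
    have "partition_cell P ((T ^^ n) x) = D"
      by (rule partition_cell_eq[OF p C(3)]) (use Suc.prems(2) C(1) in blast)
    moreover have "(T ^^ n) y \<in> space M"
      using measurable_compose_n[OF T] xy(2) by (rule measurable_space)
    then have "(T ^^ n) y \<in> partition_cell P ((T ^^ n) y)" by (rule partition_cell_mem[OF p])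
    moreover have "partition_cell P ((T ^^ n) x) = partition_cell P ((T ^^ n) y)"
      by (rule Suc.prems(3)) simp
    moreover have "y \<in> C'"
      by (rule Suc.IH[OF C(2)]) (use Suc.prems(2) C(1) in blast, rule Suc.prems(3)[OF less_SucI])
    ultimately show ?case unfolding C(1) using xy by auto
  next
    case 0
    from 0(1) xy show ?case by simp
  qed
  moreover have q: "partition_on (space M) (iterated_join M T P n)"
    using finite_measurable_partition_iterated_join[OF M T P] by (auto simp: finite_measurable_partition_def)
  ultimately have "y \<in> partition_cell (iterated_join M T P n) x"
    using partition_cell_mem[OF q xy(1)] by auto
  with partition_cell_mem[OF q xy(1)] show ?thesis
    by (intro partition_cell_eq[OF q, symmetric])
qed

section \<open>Small entropy from rare events and codes\<close>

lemma neg_mult_ln_le_sqrt: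
  assumes "0 \<le> t" shows "- (t * ln t) \<le> 2 * sqrt t"
proof (cases "t = 0")
  case False
  with assms have t: "t > 0" by simp
  \<comment> \<open>The inequality \<open>ln s \<le> s - 1\<close> is applied at
    \<open>1 / sqrt t\<close> rather than at \<open>1 / t\<close>, so that the resulting bound tends
    to \<open>0\<close> with \<open>t\<close>.\<close>
  have "ln (1 / sqrt t) \<le> 1 / sqrt t - 1" using t by (intro ln_le_minus_one) auto
  moreover have "ln (1 / sqrt t) = - ln t / 2" using t by (simp add: ln_div ln_sqrt)
  ultimately have "- ln t \<le> 2 * (1 / sqrt t)" by simp
  then have "t * (- ln t) \<le> t * (2 * (1 / sqrt t))" using t by (intro mult_left_mono) auto
  also have "\<dots> = 2 * (t / sqrt t)" by simp
  also have "\<dots> = 2 * sqrt t" using t by (subst real_div_sqrt) auto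
  finally show ?thesis by simp
qed simp

text \<open>The bound vanishes at \<open>t = 1\<close>, so it suits a value taken with probability
  close to one.\<close>

lemma neg_mult_ln_le_one_minus:
  assumes "0 \<le> t" "t \<le> (1::real)" shows "- (t * ln t) \<le> 1 - t"
proof (cases "t = 0")
  case False
  with assms have t: "t > 0" by simp
  have "ln (1 / t) \<le> 1 / t - 1" using t by (intro ln_le_minus_one) auto
  then have "t * (- ln t) \<le> t * (1 / t - 1)" using t by (intro mult_left_mono) (auto simp: ln_div)
  then show ?thesis using t by (simp add: algebra_simps)
qed simp

lemma log_exp1: "log (exp 1) x = ln (x::real)"
  by (simp add: log_def)

text \<open>The value \<open>d\<close> contributes at most \<open>\<epsilon>\<close>, and each of
  the at most \<open>card F\<close> others at most \<open>2 * sqrt \<epsilon>\<close>.\<close>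

lemma entropy_rare_event_le:
  assumes "prob_space M" and D: "simple_function M D" and F: "finite F" "D ` space M \<subseteq> insert d F"
    and small: "measure M {x \<in> space M. D x \<noteq> d} \<le> \<epsilon>"
  shows "prob_space.entropy M (exp 1) (count_space (D ` space M)) D \<le> \<epsilon> + real (card F) * (2 * sqrt \<epsilon>)"
proof -
  interpret prob_space M by fact
  interpret information_space M "exp 1" by unfold_locales simp
  define p where "p c = prob (D -` {c} \<inter> space M)" for c
  have ms: "D -` S \<inter> space M \<in> sets M" for S using D by (rule simple_functionD)
  have B: "{x \<in> space M. D x \<noteq> d} = space M - (D -` {d} \<inter> space M)" by auto
  have pd: "1 - p d \<le> \<epsilon>"
    using small ms[of "{d}"] unfolding B p_def by (simp add: prob_compl)
  have pc: "p c \<le> \<epsilon>" if "c \<noteq> d" for c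
  proof -
    have "p c \<le> prob {x \<in> space M. D x \<noteq> d}"
      unfolding p_def B using ms that by (intro finite_measure_mono) auto
    then show ?thesis using small by simp
  qed
  have "entropy_Pow (D) = - (\<Sum>c\<in>insert d F. p c * ln (p c))"
    using entropy_simple_superset[OF D _ F(2)] F(1) by (simp add: p_def log_exp1)
  also have "\<dots> = - (p d * ln (p d)) + (\<Sum>c\<in>F - {d}. - (p c * ln (p c)))"
    using F(1) by (simp add: sum.insert_remove sum_negf)
  also have "\<dots> \<le> \<epsilon> + (\<Sum>c\<in>F - {d}. 2 * sqrt \<epsilon>)"
  proof (intro add_mono sum_mono)
    show "- (p d * ln (p d)) \<le> \<epsilon>"
      using neg_mult_ln_le_one_minus[of "p d"] pd by (simp add: p_def)
    fix c assume "c \<in> F - {d}"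
    then have "p c \<le> \<epsilon>" using pc by auto
    then have "2 * sqrt (p c) \<le> 2 * sqrt \<epsilon>" by simp
    moreover have "- (p c * ln (p c)) \<le> 2 * sqrt (p c)"
      by (rule neg_mult_ln_le_sqrt) (simp add: p_def)
    ultimately show "- (p c * ln (p c)) \<le> 2 * sqrt \<epsilon>" by linarith
  qed
  also have "\<dots> \<le> \<epsilon> + real (card F) * (2 * sqrt \<epsilon>)"
  proof -
    have "0 \<le> \<epsilon>" using small measure_nonneg order_trans by blast
    moreover have "card (F - {d}) \<le> card F" using F(1) by (intro card_mono) auto
    ultimately show ?thesis by (simp add: mult_right_mono)
  qed
  finally show ?thesis .
qed

text \<open>By \<open>code\<close>, \<open>W\<close> and the reports of \<open>D\<close> along the
  orbit determine the itinerary for \<open>n\<close> steps. This bounds the entropy of the join by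
  that of \<open>W\<close> plus \<open>n * \<eta>\<close>, and division by \<open>n\<close> removes
  the first term in the limit.\<close>

lemma partition_dynamical_entropy_eq_0:
  assumes "prob_space M" and T: "T \<in> measurable M M" "distr M M T = M"
    and P: "finite_measurable_partition M P"
    and code: "\<And>\<eta>. \<eta> > 0 \<Longrightarrow> \<exists>(W :: 'a \<Rightarrow> 'b) (D :: 'a \<Rightarrow> 'c).
      simple_function M W \<and> simple_function M D \<and>
      prob_space.entropy M (exp 1) (count_space (D ` space M)) D \<le> \<eta> \<and>
      (\<forall>n. \<forall>x\<in>space M. \<forall>y\<in>space M. W x = W y \<longrightarrow> (\<forall>i<n. D ((T ^^ i) x) = D ((T ^^ i) y)) \<longrightarrow>
        (\<forall>i<n. partition_cell P ((T ^^ i) x) = partition_cell P ((T ^^ i) y)))"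
  shows "partition_dynamical_entropy M T P = 0"
proof -
  interpret prob_space M by fact
  interpret information_space M "exp 1" by unfold_locales simp
  define h where "h n = partition_entropy M (iterated_join M T P n)" for n
  have J: "finite_measurable_partition M (iterated_join M T P n)" for n
    by (rule finite_measurable_partition_iterated_join[OF not_empty T(1) P])
  have h_nonneg: "0 \<le> h n" for n
  proof -
    have "0 \<le> - (measure M C * ln (measure M C))" for C
    proof (cases "measure M C = 0")
      case False
      then have "measure M C > 0" by (simp add: zero_less_measure_iff)
      then have "ln (measure M C) \<le> 0" by simp
      then show ?thesis by (simp add: mult_nonneg_nonpos)
    qed simp
    then show ?thesis
      unfolding h_def partition_entropy_def sum_negf[symmetric] by (rule sum_nonneg)
  qed
  have "(\<lambda>n. (1 / real n) * h n) \<longlonglongrightarrow> 0"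
  proof (rule LIMSEQ_I)
    fix r :: real assume r: "r > 0"
    obtain W :: "'a \<Rightarrow> 'b" and D :: "'a \<Rightarrow> 'c" where
      W: "simple_function M W" and D: "simple_function M D" and HD: "entropy_Pow (D) \<le> r / 2" and
      det: "\<And>n x y. x \<in> space M \<Longrightarrow> y \<in> space M \<Longrightarrow> W x = W y \<Longrightarrow>
        (\<forall>i<n. D ((T ^^ i) x) = D ((T ^^ i) y)) \<Longrightarrow>
        (\<forall>i<n. partition_cell P ((T ^^ i) x) = partition_cell P ((T ^^ i) y))"
    proof -
      from r have "r / 2 > 0" by simp
      from code[OF this] show thesis
        by (elim exE conjE) (rule that, assumption, assumption, assumption, blast)
    qed
    have hle: "h n \<le> entropy_Pow (W) + real n * (r / 2)" for n
    proof -
      define V where "V = (\<lambda>x. (W x, map (\<lambda>i. D ((T ^^ i) x)) [0..<n]))"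
      have V: "simple_function M V" "entropy_Pow (V) \<le> entropy_Pow (W) + real n * entropy_Pow (D)"
        using entropy_iterates_le[OF W D T, of n] by (auto simp: V_def)
      have "h n = entropy_Pow (partition_cell (iterated_join M T P n))"
        unfolding h_def by (rule partition_entropy_eq_entropy[OF \<open>prob_space M\<close> J])
      also have "\<dots> \<le> entropy_Pow (V)"
      proof (rule entropy_mono_determined[OF simple_function_partition_cell[OF J] V(1)])
        fix x y assume xy: "x \<in> space M" "y \<in> space M" "V x = V y"
        then have "W x = W y" "\<forall>i<n. D ((T ^^ i) x) = D ((T ^^ i) y)"
          by (auto simp: V_def)
        from det[OF xy(1,2) this]
        show "partition_cell (iterated_join M T P n) x = partition_cell (iterated_join M T P n) y"
          by (intro iterated_join_cell_eqI[OF not_empty T(1) P xy(1,2)]) auto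
      qed
      also have "\<dots> \<le> entropy_Pow (W) + real n * (r / 2)"
        using V(2) HD by (smt (verit) mult_left_mono of_nat_0_le_iff)
      finally show ?thesis .
    qed
    obtain N :: nat where N: "N > 0" "\<bar>entropy_Pow (W)\<bar> / (r / 2) < real N"
      using reals_Archimedean2[of "\<bar>entropy_Pow (W)\<bar> / (r / 2)"] r
      by (metis abs_ge_zero divide_nonneg_pos gr0I half_gt_zero not_less of_nat_0)
    show "\<exists>N. \<forall>n\<ge>N. norm ((1 / real n) * h n - 0) < r"
    proof (intro exI allI impI)
      fix n assume n: "n \<ge> N"
      then have n0: "real n > 0" using N by simp
      have "\<bar>entropy_Pow (W)\<bar> < real N * (r / 2)" using N(2) r by (simp add: divide_simps mult.commute)
      also have "\<dots> \<le> real n * (r / 2)" using n r by (intro mult_right_mono) auto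
      finally have "h n < real n * r" using hle[of n] by simp
      then show "norm ((1 / real n) * h n - 0) < r"
        using n0 h_nonneg[of n] by (simp add: divide_simps mult.commute)
    qed
  qed
  then show ?thesis unfolding partition_dynamical_entropy_def h_def by (rule limI)
qed

section \<open>The shift space and its invariant measures\<close>

lemma closed_Collect_coordinate: "closed {x :: int \<Rightarrow> nat. x l \<in> S}"
proof -
  have "closed ((\<lambda>x :: int \<Rightarrow> nat. x l) -` S)"
    by (rule closed_vimage) (auto simp: closed_def open_discrete)
  then show ?thesis by (simp add: vimage_def)
qed

lemma open_Collect_coordinate: "open {x :: int \<Rightarrow> nat. x l \<in> S}"
  using closed_Collect_coordinate[of l "- S"] by (simp add: closed_def Collect_neg_eq[symmetric])

lemma closed_Sigma_space: "closed (Sigma_space k)"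
  unfolding Sigma_space_def by (intro closed_Collect_all closed_Collect_coordinate)

lemma compact_Sigma_space: "compact (Sigma_space k)"
proof -
  have "compactin (product_topology (\<lambda>i::int. euclidean :: nat topology) UNIV) (PiE UNIV (\<lambda>_. {1..k}))"
    by (subst compactin_PiE) (auto simp: finite_imp_compact)
  moreover have "Sigma_space k = PiE UNIV (\<lambda>_. {1..k})" by (auto simp: Sigma_space_def PiE_def)
  ultimately show ?thesis by (simp add: euclidean_product_topology)
qed

lemma sets_shift_measure_iff:
  assumes "sets M = sets (restrict_space borel (Sigma_space k))"
  shows "B \<in> sets M \<longleftrightarrow> B \<subseteq> Sigma_space k \<and> B \<in> sets borel"
  unfolding assms by (intro sets_restrict_space_iff) (use closed_Sigma_space in auto)

lemma space_shift_measure: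
  assumes "sets M = sets (restrict_space borel (Sigma_space k))"
  shows "space M = Sigma_space k"
  using sets_eq_imp_space_eq[OF assms] by (simp add: space_restrict_space)

lemma continuous_left_shift: "continuous_on S left_shift"
  unfolding left_shift_def
  by (intro continuous_on_coordinatewise_then_product continuous_on_subset[OF continuous_on_product_coordinates]) auto

lemma left_shift_Sigma_space: "x \<in> Sigma_space k \<Longrightarrow> left_shift x \<in> Sigma_space k"
  by (auto simp: Sigma_space_def left_shift_def)

lemma measurable_left_shift:
  assumes M: "sets M = sets (restrict_space borel (Sigma_space k))"
  shows "left_shift \<in> measurable M M"
proof (rule measurableI)
  fix B assume "B \<in> sets M"
  then have B: "B \<subseteq> Sigma_space k" "B \<in> sets borel" using sets_shift_measure_iff[OF M] by auto
  have "left_shift \<in> borel_measurable borel"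
    by (rule borel_measurable_continuous_onI[OF continuous_left_shift])
  then have "left_shift -` B \<in> sets borel" using B measurable_sets_borel by blast
  then show "left_shift -` B \<inter> space M \<in> sets M"
    unfolding sets_shift_measure_iff[OF M] space_shift_measure[OF M]
    using closed_Sigma_space by auto
qed (simp add: space_shift_measure[OF M] left_shift_Sigma_space)

text \<open>Lusin's argument: replace the level sets of \<open>f\<close>, off the null set \<open>Z\<close>, by compact subsets.
  Points of two different such sets never have the same past, and by compactness this is already
  visible in a finite window.\<close>

lemma finite_window_determines:
  assumes "prob_space M" and M: "sets M = sets (restrict_space borel (Sigma_space k))"
    and f: "simple_function M f" and Z: "Z \<in> null_sets M"
    and det: "\<And>x y. x \<in> space M - Z \<Longrightarrow> y \<in> space M - Z \<Longrightarrow> (\<forall>l<0. x l = y l) \<Longrightarrow> f x = f y"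
    and eps: "\<epsilon> > 0"
  obtains m :: nat and B where "B \<in> sets M" "measure M B \<le> \<epsilon>"
    "\<And>x y. x \<in> space M - B \<Longrightarrow> y \<in> space M - B \<Longrightarrow> (\<forall>l\<in>{- int m..<0}. x l = y l) \<Longrightarrow> f x = f y"
proof -
  interpret prob_space M by fact
  \<comment> \<open>\<open>\<iota>\<close> embeds the shift space into
    \<open>int \<Rightarrow> real\<close>, a complete separable metric space, so that
    \<open>inner_regular\<close> applies to the image measure \<open>N\<close>. Its left inverse
    \<open>\<rho>\<close> carries measurable sets over.\<close>
  define \<iota> :: "(int \<Rightarrow> nat) \<Rightarrow> int \<Rightarrow> real" where "\<iota> x = (\<lambda>l. real (x l))" for x
  define \<rho> :: "(int \<Rightarrow> real) \<Rightarrow> int \<Rightarrow> nat" where "\<rho> y = (\<lambda>l. nat \<lfloor>y l\<rfloor>)" for y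
  have \<rho>\<iota>: "\<rho> (\<iota> x) = x" for x by (simp add: \<rho>_def \<iota>_def)
  have \<iota>_borel: "\<iota> \<in> borel_measurable borel"
    unfolding \<iota>_def
  proof (rule measurable_coordinatewise_then_product)
    fix l
    have "continuous_on UNIV real" by (simp add: continuous_on_open_vimage open_discrete)
    then show "(\<lambda>x :: int \<Rightarrow> nat. real (x l)) \<in> borel_measurable borel"
      by (intro measurable_compose[OF measurable_product_coordinates] borel_measurable_continuous_onI)
  qed
  have \<rho>_borel: "\<rho> \<in> borel_measurable borel"
    unfolding \<rho>_def
  proof (rule measurable_coordinatewise_then_product)
    fix l
    have "(\<lambda>y :: int \<Rightarrow> real. y l) \<in> borel_measurable borel" by (rule measurable_product_coordinates)
    then have "(\<lambda>y :: int \<Rightarrow> real. nat \<lfloor>y l\<rfloor>) \<in> measurable borel (count_space UNIV)" by measurable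
    then show "(\<lambda>y :: int \<Rightarrow> real. nat \<lfloor>y l\<rfloor>) \<in> borel_measurable borel"
      by (rule measurable_compose) simp
  qed
  have "\<iota> \<in> measurable (restrict_space borel (Sigma_space k)) borel"
    by (rule measurable_restrict_space1[OF \<iota>_borel])
  then have \<iota>_meas: "\<iota> \<in> measurable M borel" using measurable_cong_sets[OF M refl] by blast
  define N where "N = distr M borel \<iota>"
  interpret N: prob_space N unfolding N_def by (rule prob_space_distr[OF \<iota>_meas])
  have sN: "sets N = sets borel" by (simp add: N_def)
  define F where "F = f ` space M"
  have F: "finite F" using simple_functionD(1)[OF f] by (simp add: F_def)
  \<comment> \<open>Each of the \<open>card F\<close> level sets may lose this much; the summand
    \<open>1\<close> keeps the denominator positive.\<close>
  define \<epsilon>' where "\<epsilon>' = \<epsilon> / (real (card F) + 1)"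
  have \<epsilon>': "\<epsilon>' > 0" using eps by (simp add: \<epsilon>'_def)
  define C where "C c = f -` {c} \<inter> space M - Z" for c
  have C_sets: "C c \<in> sets M" for c unfolding C_def using simple_functionD(2)[OF f] Z by auto
  have R_borel: "\<rho> -` C c \<in> sets borel" for c
    using C_sets[of c] \<rho>_borel by (auto simp: sets_shift_measure_iff[OF M] intro: measurable_sets_borel)
  have "\<exists>K. compact K \<and> K \<subseteq> \<rho> -` C c \<and> measure M (C c - \<iota> -` K) \<le> \<epsilon>'" for c
  proof -
    have "\<exists>K\<in>{K. K \<subseteq> \<rho> -` C c \<and> compact K}. emeasure N (\<rho> -` C c) < emeasure N K + ennreal \<epsilon>'"
    proof (rule ccontr)
      assume "\<not> ?thesis"
      then have "emeasure N K + ennreal \<epsilon>' \<le> emeasure N (\<rho> -` C c)"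
        if "K \<in> {K. K \<subseteq> \<rho> -` C c \<and> compact K}" for K
        using that by (auto simp: not_less)
      then have "(SUP K\<in>{K. K \<subseteq> \<rho> -` C c \<and> compact K}. emeasure N K + ennreal \<epsilon>')
          \<le> emeasure N (\<rho> -` C c)"
        by (rule SUP_least)
      moreover have "(SUP K\<in>{K. K \<subseteq> \<rho> -` C c \<and> compact K}. emeasure N K + ennreal \<epsilon>')
          = (SUP K\<in>{K. K \<subseteq> \<rho> -` C c \<and> compact K}. emeasure N K) + ennreal \<epsilon>'"
        by (rule ennreal_SUP_add_left) (auto intro: exI[of _ "{}"])
      moreover have "(SUP K\<in>{K. K \<subseteq> \<rho> -` C c \<and> compact K}. emeasure N K) = emeasure N (\<rho> -` C c)"
        by (rule inner_regular[symmetric]) (auto simp: sN N.emeasure_space_1 R_borel)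
      ultimately have "emeasure N (\<rho> -` C c) + ennreal \<epsilon>' \<le> emeasure N (\<rho> -` C c)" by simp
      then show False using \<epsilon>'
        by (simp add: N.emeasure_eq_measure ennreal_plus[symmetric] del: ennreal_plus)
    qed
    then obtain K where K: "K \<subseteq> \<rho> -` C c" "compact K" "emeasure N (\<rho> -` C c) < emeasure N K + ennreal \<epsilon>'"
      by blast
    have Kb: "K \<in> sets borel" using K(2) by (simp add: borel_compact)
    have "measure N (\<rho> -` C c) < measure N K + \<epsilon>'"
      using K(3) \<epsilon>'
      by (simp add: N.emeasure_eq_measure ennreal_plus[symmetric] ennreal_less_iff del: ennreal_plus)
    moreover have "measure N (\<rho> -` C c) = measure M (C c)"
    proof -
      have "\<iota> -` (\<rho> -` C c) \<inter> space M = C c" using sets.sets_into_space[OF C_sets[of c]] by (auto simp: \<rho>\<iota>)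
      then show ?thesis using measure_distr[OF \<iota>_meas R_borel[of c]] by (simp add: N_def)
    qed
    moreover have "\<iota> -` K \<inter> space M \<subseteq> C c"
      using K(1) by (auto simp: \<rho>\<iota> dest!: subsetD)
    moreover have "\<iota> -` K \<inter> space M \<in> sets M" by (rule measurable_sets[OF \<iota>_meas Kb])
    moreover have "measure N K = measure M (\<iota> -` K \<inter> space M)"
      using measure_distr[OF \<iota>_meas Kb] by (simp add: N_def)
    moreover have "C c - \<iota> -` K = C c - (\<iota> -` K \<inter> space M)"
      using sets.sets_into_space[OF C_sets[of c]] by auto
    ultimately have "measure M (C c - \<iota> -` K) \<le> \<epsilon>'"
      using C_sets[of c] by (simp add: finite_measure_Diff)
    then show ?thesis using K by blast
  qed
  then obtain K where K: "\<And>c. compact (K c)" "\<And>c. K c \<subseteq> \<rho> -` C c"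
    "\<And>c. measure M (C c - \<iota> -` K c) \<le> \<epsilon>'" by metis
  have Ks: "\<iota> -` K c \<inter> space M \<in> sets M" for c
    by (rule measurable_sets[OF \<iota>_meas]) (simp add: borel_compact K(1))
  define B where "B = space M - (\<Union>c\<in>F. \<iota> -` K c \<inter> space M)"
  have B_sets: "B \<in> sets M" unfolding B_def by (intro sets.Diff sets.top sets.finite_UN F Ks)
  have B_small: "measure M B \<le> \<epsilon>"
  proof -
    have CK: "C c - \<iota> -` K c = C c - (\<iota> -` K c \<inter> space M)" for c
      using sets.sets_into_space[OF C_sets[of c]] by auto
    have s: "C c - \<iota> -` K c \<in> sets M" for c unfolding CK using C_sets Ks by auto
    have sub: "B \<subseteq> Z \<union> (\<Union>c\<in>F. C c - \<iota> -` K c)"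
      by (auto simp: B_def F_def C_def)
    have "measure M B \<le> measure M (Z \<union> (\<Union>c\<in>F. C c - \<iota> -` K c))"
      by (rule finite_measure_mono[OF sub]) (use s F Z in auto)
    also have "\<dots> \<le> measure M Z + measure M (\<Union>c\<in>F. C c - \<iota> -` K c)"
      by (rule measure_Un_le) (use s F Z in auto)
    also have "measure M Z = 0" using Z by (simp add: measure_def null_setsD1)
    also have "measure M (\<Union>c\<in>F. C c - \<iota> -` K c) \<le> (\<Sum>c\<in>F. measure M (C c - \<iota> -` K c))"
      by (rule finite_measure_subadditive_finite[OF F]) (use s in auto)
    also have "\<dots> \<le> (\<Sum>c\<in>F. \<epsilon>')" by (rule sum_mono) (rule K(3))
    also have "\<dots> \<le> \<epsilon>" using eps by (simp add: \<epsilon>'_def field_simps)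
    finally show ?thesis by simp
  qed
  \<comment> \<open>Pairs taken from the compact pieces of two different values form the compact set
    \<open>S\<close>, and pairs that agree at \<open>l\<close> the closed set \<open>E l\<close>.
    Agreement on a whole past is thus an intersection of closed sets, open to the finite
    intersection property.\<close>
  define S where "S = (\<Union>c\<in>F. \<Union>c'\<in>F - {c}. K c \<times> K c')"
  define E where "E l = {p :: (int \<Rightarrow> real) \<times> (int \<Rightarrow> real). fst p l = snd p l}" for l
  have "compact S" unfolding S_def
    by (intro compact_UN finite_Diff F compact_Times K)
  have E_closed: "closed (E l)" for l
  proof -
    have c: "continuous_on UNIV (\<lambda>y :: int \<Rightarrow> real. y l)" by simp
    show ?thesis unfolding E_def
      by (intro closed_Collect_eq continuous_on_compose2[OF c] continuous_intros) auto
  qed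
  have S_empty: "S \<inter> \<Inter> (E ` {..<0}) = {}"
  proof (rule equals0I)
    fix p assume p: "p \<in> S \<inter> \<Inter> (E ` {..<0})"
    then obtain c c' where c: "c' \<in> F - {c}" "fst p \<in> K c" "snd p \<in> K c'"
      unfolding S_def by fastforce
    then have r: "\<rho> (fst p) \<in> C c" "\<rho> (snd p) \<in> C c'" using K(2) by auto
    have "\<forall>l<0. \<rho> (fst p) l = \<rho> (snd p) l" using p by (auto simp: E_def \<rho>_def)
    then have "f (\<rho> (fst p)) = f (\<rho> (snd p))" using r by (intro det) (auto simp: C_def)
    then show False using r c(1) by (auto simp: C_def)
  qed
  obtain I' where I': "finite I'" "I' \<subseteq> {..<0}" "S \<inter> \<Inter> (E ` I') = {}"
  proof (rule ccontr)
    assume n: "\<not> thesis"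
    have "S \<inter> \<Inter> (E ` {..<0}) \<noteq> {}"
      by (rule compact_imp_fip_image[OF \<open>compact S\<close> E_closed]) (use n that in blast)
    then show False using S_empty by simp
  qed
  \<comment> \<open>Inserting \<open>0\<close> covers the case of an empty \<open>I'\<close>, where
    the window is empty too.\<close>
  define m where "m = nat (- Min (insert 0 I'))"
  have m: "I' \<subseteq> {- int m..<0}"
  proof
    fix l assume l: "l \<in> I'"
    then have "Min (insert 0 I') \<le> l" using I'(1) by (intro Min_le) auto
    then show "l \<in> {- int m..<0}" using l I'(2) by (auto simp: m_def)
  qed
  show thesis
  proof (rule that[OF B_sets B_small, of m])
    fix x y assume xy: "x \<in> space M - B" "y \<in> space M - B" and eq: "\<forall>l\<in>{- int m..<0}. x l = y l"
    obtain c where c: "c \<in> F" "\<iota> x \<in> K c" using xy(1) by (auto simp: B_def)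
    obtain c' where c': "c' \<in> F" "\<iota> y \<in> K c'" using xy(2) by (auto simp: B_def)
    have "x \<in> C c" "y \<in> C c'" using subsetD[OF K(2) c(2)] subsetD[OF K(2) c'(2)] by (auto simp: \<rho>\<iota>)
    then have "f x = c" "f y = c'" by (auto simp: C_def)
    moreover have "c = c'"
    proof (rule ccontr)
      assume "c \<noteq> c'"
      then have "(\<iota> x, \<iota> y) \<in> S" using c c' by (auto simp: S_def)
      moreover have "(\<iota> x, \<iota> y) \<in> \<Inter> (E ` I')" using eq m by (auto simp: E_def \<iota>_def)
      ultimately show False using I'(3) by blast
    qed
    ultimately show "f x = f y" by simp
  qed
qed

section \<open>Integrals of the cocycle\<close>

lemma closed_Collect_word: "closed {x :: int \<Rightarrow> nat. map x ls = w}"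
proof (induction ls arbitrary: w)
  case (Cons l ls)
  show ?case
  proof (cases w)
    case (Cons i w')
    have "{x :: int \<Rightarrow> nat. map x (l # ls) = w} = {x. x l \<in> {i}} \<inter> {x. map x ls = w'}"
      using Cons by auto
    then show ?thesis using closed_Collect_coordinate[of l "{i}"] Cons.IH by auto
  qed simp
qed simp

text \<open>Words are countably many, so it is enough that each cylinder is measurable.\<close>

lemma measurable_word_function:
  assumes M: "sets M = sets (restrict_space borel (Sigma_space k))"
  shows "(\<lambda>x. G (map x ls)) \<in> borel_measurable M"
proof -
  have "(\<lambda>x :: int \<Rightarrow> nat. map x ls) \<in> measurable M (count_space UNIV)"
  proof (subst measurable_count_space_eq_countable)
    have "{x :: int \<Rightarrow> nat. map x ls = w} \<inter> space M \<in> sets M" for w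
      unfolding sets_shift_measure_iff[OF M] space_shift_measure[OF M]
      using closed_Collect_word closed_Sigma_space by auto
    then show "(\<lambda>x. map x ls) \<in> space M \<rightarrow> UNIV \<and> (\<forall>a\<in>UNIV. (\<lambda>x. map x ls) -` {a} \<inter> space M \<in> sets M)"
      by (auto simp: vimage_def)
  qed simp
  then show ?thesis by (rule measurable_compose) simp
qed

lemma op_norm_cocycle_measurable:
  assumes M: "sets M = sets (restrict_space borel (Sigma_space k))"
  shows "(\<lambda>x. ln (op_norm (cocycle A n x))) \<in> borel_measurable M"
  using measurable_word_function[OF M, of "\<lambda>w. ln (op_norm (word_product A w))" "map int [0..<n]"]
  by (simp add: cocycle_eq_word_product comp_def)

lemma ln_op_norm_cocycle_integrable:
  assumes M: "invariant_prob_measure k M" and SL2: "\<forall>i\<in>{1..k}. det (A i) = 1"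
  shows "integrable M (\<lambda>x. ln (op_norm (cocycle A n x)))"
proof -
  have Ms: "sets M = sets (restrict_space borel (Sigma_space k))" and "prob_space M"
    using M by (auto simp: invariant_prob_measure_def)
  interpret prob_space M by fact
  obtain B where B: "B \<ge> 1" "\<And>n x. x \<in> Sigma_space k \<Longrightarrow> op_norm (cocycle A n x) \<le> B ^ n"
    using cocycle_norm_bound[of k A] by blast
  show ?thesis
  proof (rule integrable_const_bound[of _ "ln (B ^ n)"])
    show "AE x in M. norm (ln (op_norm (cocycle A n x))) \<le> ln (B ^ n)"
    proof (rule AE_I2)
      fix x assume "x \<in> space M"
      then have x: "x \<in> Sigma_space k" using space_shift_measure[OF Ms] by simp
      have "1 \<le> op_norm (cocycle A n x)" by (rule op_norm_ge_1[OF det_cocycle[OF SL2 x]])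
      moreover from this have "ln (op_norm (cocycle A n x)) \<le> ln (B ^ n)"
        using B(2)[OF x, of n] by (intro ln_mono) auto
      ultimately show "norm (ln (op_norm (cocycle A n x))) \<le> ln (B ^ n)" by simp
    qed
  qed (rule op_norm_cocycle_measurable[OF Ms])
qed

lemma measurable_left_shift_funpow:
  "sets M = sets (restrict_space borel (Sigma_space k)) \<Longrightarrow> left_shift ^^ n \<in> measurable M M"
  by (intro measurable_compose_n measurable_left_shift)

lemma invariant_prob_measure_funpow:
  assumes "invariant_prob_measure k M"
  shows "distr M M (left_shift ^^ n) = M"
proof (induction n)
  case (Suc n)
  have M: "sets M = sets (restrict_space borel (Sigma_space k))" "distr M M left_shift = M"
    using assms by (auto simp: invariant_prob_measure_def)
  have "distr M M (left_shift \<circ> left_shift ^^ n) = distr (distr M M (left_shift ^^ n)) M left_shift"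
    by (rule distr_distr[symmetric, OF measurable_left_shift[OF M(1)] measurable_left_shift_funpow[OF M(1)]])
  moreover have "left_shift ^^ Suc n = left_shift \<circ> left_shift ^^ n" by simp
  ultimately show ?case using Suc M(2) by metis
qed (simp add: id_def)

lemma integral_shift:
  fixes g :: "(int \<Rightarrow> nat) \<Rightarrow> real"
  assumes M: "invariant_prob_measure k M" and g: "integrable M g"
  shows "integrable M (\<lambda>x. g ((left_shift ^^ n) x))"
    "(\<integral>x. g ((left_shift ^^ n) x) \<partial>M) = (\<integral>x. g x \<partial>M)"
proof -
  have Ms: "sets M = sets (restrict_space borel (Sigma_space k))"
    using M by (auto simp: invariant_prob_measure_def)
  note T = measurable_left_shift_funpow[OF Ms, of n]
  note d = invariant_prob_measure_funpow[OF M, of n]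
  show "integrable M (\<lambda>x. g ((left_shift ^^ n) x))"
    by (rule integrable_distr[OF T]) (simp add: d g)
  show "(\<integral>x. g ((left_shift ^^ n) x) \<partial>M) = (\<integral>x. g x \<partial>M)"
    using integral_distr[OF T borel_measurable_integrable[OF g]] by (simp add: d)
qed

text \<open>Invariance makes the integrals subadditive, so the exponent is the infimum of their
  quotients by \<open>n\<close> and not merely the limit.\<close>

lemma lyapunov_exponent_le_integral:
  assumes M: "invariant_prob_measure k M" and SL2: "\<forall>i\<in>{1..k}. det (A i) = 1"
  shows "real n * lyapunov_exponent A M \<le> (\<integral>x. ln (op_norm (cocycle A n x)) \<partial>M)"
proof -
  define a where "a n = (\<integral>x. ln (op_norm (cocycle A n x)) \<partial>M)" for n
  have Ms: "sets M = sets (restrict_space borel (Sigma_space k))"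
    using M by (auto simp: invariant_prob_measure_def)
  have ge1: "1 \<le> op_norm (cocycle A n x)" if "x \<in> space M" for n x
    using op_norm_ge_1[OF det_cocycle[OF SL2]] that by (simp add: space_shift_measure[OF Ms])
  note int = ln_op_norm_cocycle_integrable[OF M SL2]
  have nonneg: "0 \<le> a n" for n
    unfolding a_def by (rule integral_nonneg_AE) (use ge1 in \<open>auto intro!: AE_I2\<close>)
  have sub: "a (m + n) \<le> a m + a n" for m n
  proof -
    have "a (m + n) \<le> (\<integral>x. ln (op_norm (cocycle A m ((left_shift ^^ n) x))) + ln (op_norm (cocycle A n x)) \<partial>M)"
      unfolding a_def
    proof (rule integral_mono[OF int Bochner_Integration.integrable_add[OF integral_shift(1)[OF M int] int]])
      fix x assume x: "x \<in> space M"
      then have Tx: "(left_shift ^^ n) x \<in> space M"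
        by (rule measurable_space[OF measurable_left_shift_funpow[OF Ms]])
      have "op_norm (cocycle A (m + n) x)
          \<le> op_norm (cocycle A m ((left_shift ^^ n) x)) * op_norm (cocycle A n x)"
        unfolding cocycle_add by (rule op_norm_mult_le)
      then show "ln (op_norm (cocycle A (m + n) x))
          \<le> ln (op_norm (cocycle A m ((left_shift ^^ n) x))) + ln (op_norm (cocycle A n x))"
        using ge1[OF x, of "m + n"] ge1[OF Tx, of m] ge1[OF x, of n]
        by (metis ln_mono ln_mult_pos less_le_trans zero_less_one)
    qed
    also have "\<dots> = a m + a n"
      unfolding a_def Bochner_Integration.integral_add[OF integral_shift(1)[OF M int] int]
        integral_shift(2)[OF M int] ..
    finally show ?thesis .
  qed
  obtain L where L: "(\<lambda>n. a n / real n) \<longlonglongrightarrow> L" "\<And>n. real n * L \<le> a n"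
    using subadditive_tendsto_Inf[of a] nonneg sub by blast
  have "lyapunov_exponent A M = L"
    unfolding lyapunov_exponent_def a_def[symmetric] using limI[OF L(1)] by simp
  then show ?thesis using L(2)[of n] by (simp add: a_def)
qed

section \<open>Supports of invariant measures\<close>

lemma measure_support_props:
  assumes M: "invariant_prob_measure k M"
  shows "measure_support M \<subseteq> Sigma_space k" "closed (measure_support M)"
    "Sigma_space k - measure_support M \<in> null_sets M"
proof -
  have Ms: "sets M = sets (restrict_space borel (Sigma_space k))"
    using M by (auto simp: invariant_prob_measure_def)
  note sp = space_shift_measure[OF Ms]
  define \<U> where "\<U> = {U :: (int \<Rightarrow> nat) set. open U \<and> emeasure M (U \<inter> space M) = 0}"
  have eq: "measure_support M = Sigma_space k - \<Union> \<U>"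
    by (auto simp: measure_support_def \<U>_def sp zero_less_iff_neq_zero)
  then show "measure_support M \<subseteq> Sigma_space k" by auto
  show "closed (measure_support M)"
    unfolding eq by (intro closed_Diff closed_Sigma_space open_Union) (auto simp: \<U>_def)
  \<comment> \<open>Countably many null open sets already cover the complement of the
    support.\<close>
  obtain \<V> where V: "\<V> \<subseteq> \<U>" "countable \<V>" "\<Union> \<V> = \<Union> \<U>"
    using Lindelof[of \<U>] by (auto simp: \<U>_def)
  have "(\<Union>U\<in>\<V>. U \<inter> space M) \<in> null_sets M"
  proof (rule null_sets_UN'[OF V(2)])
    fix U assume "U \<in> \<V>"
    then have U: "open U" "emeasure M (U \<inter> space M) = 0" using V(1) by (auto simp: \<U>_def)
    have "U \<inter> space M \<in> sets M"
      unfolding sets_shift_measure_iff[OF Ms] sp using U(1) closed_Sigma_space by auto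
    then show "U \<inter> space M \<in> null_sets M" using U(2) by auto
  qed
  moreover have "Sigma_space k - measure_support M = (\<Union>U\<in>\<V>. U \<inter> space M)"
    unfolding eq sp using V(3) by auto
  ultimately show "Sigma_space k - measure_support M \<in> null_sets M" by simp
qed

definition right_shift :: "(int \<Rightarrow> nat) \<Rightarrow> (int \<Rightarrow> nat)" where
  "right_shift x = (\<lambda>l. x (l - 1))"

lemma left_right_shift [simp]: "left_shift (right_shift x) = x" "right_shift (left_shift x) = x"
  by (simp_all add: left_shift_def right_shift_def)

lemma right_shift_funpow: "(right_shift ^^ n) x = (\<lambda>l. x (l - int n))"
  by (induction n arbitrary: x) (auto simp: right_shift_def algebra_simps)

lemma continuous_right_shift: "continuous_on S right_shift"
  unfolding right_shift_def
  by (intro continuous_on_coordinatewise_then_product continuous_on_subset[OF continuous_on_product_coordinates]) auto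

lemma measure_support_shift:
  assumes M: "invariant_prob_measure k M" and x: "x \<in> measure_support M"
  shows "left_shift x \<in> measure_support M" "right_shift x \<in> measure_support M"
proof -
  have Ms: "sets M = sets (restrict_space borel (Sigma_space k))" and d: "distr M M left_shift = M"
    using M by (auto simp: invariant_prob_measure_def)
  note sp = space_shift_measure[OF Ms]
  have xs: "x \<in> Sigma_space k" and xU: "\<And>U. open U \<Longrightarrow> x \<in> U \<Longrightarrow> emeasure M (U \<inter> space M) > 0"
    using x by (auto simp: measure_support_def sp)
  have inv: "emeasure M (left_shift -` U \<inter> space M) = emeasure M (U \<inter> space M)" if "open U" for U
  proof -
    have "U \<inter> space M \<in> sets M"
      unfolding sets_shift_measure_iff[OF Ms] sp using that closed_Sigma_space by auto
    then have "emeasure (distr M M left_shift) (U \<inter> space M)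
        = emeasure M (left_shift -` (U \<inter> space M) \<inter> space M)"
      by (rule emeasure_distr[OF measurable_left_shift[OF Ms]])
    moreover have "left_shift -` (U \<inter> space M) \<inter> space M = left_shift -` U \<inter> space M"
      using left_shift_Sigma_space by (auto simp: sp)
    ultimately show ?thesis by (simp add: d)
  qed
  have op: "open (left_shift -` U)" "open (right_shift -` U)" if "open U" for U
    using that continuous_left_shift[of UNIV] continuous_right_shift[of UNIV]
    by (auto simp: continuous_on_open_vimage)
  show "left_shift x \<in> measure_support M"
    unfolding measure_support_def sp
  proof (intro CollectI conjI allI impI left_shift_Sigma_space xs)
    fix U assume U: "open U" "left_shift x \<in> U"
    then show "0 < emeasure M (U \<inter> Sigma_space k)"
      using xU[OF op(1)[OF U(1)]] inv[OF U(1)] by (simp add: sp)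
  qed
  show "right_shift x \<in> measure_support M"
    unfolding measure_support_def sp
  proof (intro CollectI conjI allI impI)
    show "right_shift x \<in> Sigma_space k" using xs by (auto simp: Sigma_space_def right_shift_def)
    fix U assume U: "open U" "right_shift x \<in> U"
    have "left_shift -` (right_shift -` U) = U" by auto
    then show "0 < emeasure M (U \<inter> Sigma_space k)"
      using xU[OF op(2)[OF U(1)]] inv[OF op(2)[OF U(1)]] U(2) by (simp add: sp)
  qed
qed

text \<open>In the quotient topology a continuous, scaling-invariant function of nonzero vectors
  descends to lines. It supplies the real functions of lines used in
  \<open>uniformly_transversal\<close>.\<close>

lemma continuous_map_projective_line:
  fixes h :: "real^2 \<Rightarrow> real"
  assumes h: "continuous_on (- {0}) h" and scale: "\<And>t v. t \<noteq> 0 \<Longrightarrow> v \<noteq> 0 \<Longrightarrow> h (t *\<^sub>R v) = h v"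
  obtains H where "continuous_map projective_line euclideanreal H"
    "\<And>L v. L \<in> lines \<Longrightarrow> v \<in> L \<Longrightarrow> v \<noteq> 0 \<Longrightarrow> H L = h v"
proof
  define H where "H L = h (SOME v. v \<in> L \<and> v \<noteq> 0)" for L
  show H: "H L = h v" if "L \<in> lines" "v \<in> L" "v \<noteq> 0" for L v
  proof -
    define w where "w = (SOME v. v \<in> L \<and> v \<noteq> 0)"
    have w: "w \<in> L \<and> w \<noteq> 0" unfolding w_def by (rule someI[of _ v]) (use that in simp)
    moreover have "L = span {v}" by (rule lines_eq_span[OF that])
    ultimately obtain t where t: "w = t *\<^sub>R v" by (auto simp: span_singleton)
    then have "t \<noteq> 0" using w by auto
    then show ?thesis unfolding H_def w_def[symmetric] t by (rule scale[OF _ that(3)])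
  qed
  show "continuous_map projective_line euclideanreal H"
    unfolding continuous_map_def
  proof (intro conjI allI impI)
    fix U :: "real set" assume "openin euclideanreal U"
    then have U: "open U" by simp
    have "{v. v \<noteq> 0 \<and> span {v} \<in> {L \<in> topspace projective_line. H L \<in> U}} = h -` U \<inter> - {0}"
    proof -
      have "H (span {v}) = h v" if "v \<noteq> 0" for v
        using H[OF span_singleton_in_lines[OF that] _ that] by (simp add: span_base)
      then show ?thesis using span_singleton_in_lines by (auto simp: topspace_projective_line)
    qed
    moreover have "open (h -` U \<inter> - {0})"
      using continuous_open_preimage[OF h _ U] by (simp add: Int_commute open_Compl)
    ultimately show "openin projective_line {L \<in> topspace projective_line. H L \<in> U}"
      by (simp add: openin_projective_line topspace_projective_line)
  qed simp
qed

section \<open>The Mather set\<close>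

text \<open>\<open>N\<close> and \<open>C\<close> come from \<open>extremal_norm_exists\<close>;
  \<open>c\<close> and \<open>\<delta>\<close> are the constants of domination.\<close>

locale extremal_splitting =
  fixes k :: nat and A :: "nat \<Rightarrow> real^2^2" and e1 e2 :: "(int \<Rightarrow> nat) \<Rightarrow> (real^2) set"
    and N :: "real^2 \<Rightarrow> real" and C c \<delta> :: real
  assumes SL2: "\<forall>i\<in>{1..k}. det (A i) = 1"
    and norm_le_N: "norm v \<le> N v"
    and N_le_norm: "N v \<le> C * norm v"
    and N_add: "N (u + v) \<le> N u + N v"
    and N_scale: "N (t *\<^sub>R v) = \<bar>t\<bar> * N v"
    and N_step: "i \<in> {1..k} \<Longrightarrow> N (A i *v v) \<le> exp (max_lyapunov_exponent k A) * N v"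
    and e1_continuous: "continuous_map (top_of_set (mather_set k A)) projective_line e1"
    and e2_continuous: "continuous_map (top_of_set (mather_set k A)) projective_line e2"
    and e_transversal: "\<omega> \<in> mather_set k A \<Longrightarrow> direct_sum_decomposition (e1 \<omega>) (e2 \<omega>)"
    and e1_step: "\<omega> \<in> mather_set k A \<Longrightarrow> (*v) (A (\<omega> 0)) ` e1 \<omega> = e1 (left_shift \<omega>)"
    and e2_step: "\<omega> \<in> mather_set k A \<Longrightarrow> (*v) (A (\<omega> 0)) ` e2 \<omega> = e2 (left_shift \<omega>)"
    and c_pos: "c > 0" and \<delta>_pos: "\<delta> > 0"
    and dominated: "\<omega> \<in> mather_set k A \<Longrightarrow> n \<ge> 1 \<Longrightarrow>
      norm_on (cocycle A n \<omega>) (e1 \<omega>) \<ge> c * exp (\<delta> * real n) * norm_on (cocycle A n \<omega>) (e2 \<omega>)"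
begin

abbreviation "K \<equiv> mather_set k A"
abbreviation "\<beta> \<equiv> max_lyapunov_exponent k A"

lemma C_ge_1: "C \<ge> 1"
  using norm_le_N[of "axis 1 1"] N_le_norm[of "axis 1 1"] by simp

lemma N_zero [simp]: "N 0 = 0"
  using N_scale[of 0 0] by simp

lemma N_pos: "v \<noteq> 0 \<Longrightarrow> 0 < N v"
  using norm_le_N[of v] zero_less_norm_iff[of v] by linarith

lemma N_diff: "\<bar>N u - N v\<bar> \<le> C * norm (u - v)"
proof -
  have "N u \<le> N (u - v) + N v" using N_add[of "u - v" v] by simp
  moreover have "N v \<le> N (v - u) + N u" using N_add[of "v - u" u] by simp
  moreover have "N (u - v) \<le> C * norm (u - v)" "N (v - u) \<le> C * norm (u - v)"
    using N_le_norm[of "u - v"] N_le_norm[of "v - u"] by (simp_all add: norm_minus_commute)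
  ultimately show ?thesis by linarith
qed

lemma N_continuous: "continuous_on S N"
proof (rule lipschitz_on_continuous_on[of C])
  show "C-lipschitz_on S N"
    using C_ge_1 N_diff by (intro lipschitz_onI) (auto simp: dist_real_def dist_norm)
qed

lemma mather_setE:
  assumes "x \<in> K"
  obtains M where "lyapunov_maximizing k A M" "x \<in> measure_support M"
  using assms by (auto simp: mather_set_def)

lemma mather_set_Sigma: "x \<in> K \<Longrightarrow> x \<in> Sigma_space k"
  by (metis mather_setE lyapunov_maximizing_def measure_support_props(1) subsetD)

lemma mather_set_symbol: "x \<in> K \<Longrightarrow> x l \<in> {1..k}"
  using mather_set_Sigma by (auto simp: Sigma_space_def)

lemma mather_set_left_shift: "x \<in> K \<Longrightarrow> left_shift x \<in> K"
  and mather_set_right_shift: "x \<in> K \<Longrightarrow> right_shift x \<in> K"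
  using measure_support_shift by (auto simp: mather_set_def lyapunov_maximizing_def; blast)+

lemma mather_set_funpow:
  "x \<in> K \<Longrightarrow> (left_shift ^^ n) x \<in> K" "x \<in> K \<Longrightarrow> (right_shift ^^ n) x \<in> K"
  by (induction n) (auto intro: mather_set_left_shift mather_set_right_shift)

lemma e_lines: "x \<in> K \<Longrightarrow> e1 x \<in> lines" "x \<in> K \<Longrightarrow> e2 x \<in> lines"
  using e1_continuous e2_continuous by (auto simp: continuous_map_def topspace_projective_line)

lemma wedge_transversal:
  assumes "x \<in> K" "u \<in> e1 x" "f \<in> e2 x" "u \<noteq> 0" "f \<noteq> 0"
  shows "wedge u f \<noteq> 0"
proof
  assume "wedge u f = 0"
  then have "f \<in> e1 x"
    using wedge_eq_0_iff[OF assms(4)] lines_eq_span[OF e_lines(1)[OF assms(1)] assms(2,4)] by simp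
  then show False using e_transversal[OF assms(1)] assms by (auto simp: direct_sum_decomposition_def)
qed

lemma cocycle_image_e:
  assumes "x \<in> K"
  shows "(*v) (cocycle A n x) ` e1 x = e1 ((left_shift ^^ n) x)"
    "(*v) (cocycle A n x) ` e2 x = e2 ((left_shift ^^ n) x)"
proof -
  have 0: "((left_shift ^^ n) x) 0 = x (int n)" for n by (simp add: left_shift_funpow)
  show "(*v) (cocycle A n x) ` e1 x = e1 ((left_shift ^^ n) x)"
  proof (induction n)
    case (Suc n)
    have "(*v) (cocycle A (Suc n) x) ` e1 x = (*v) (A (x (int n))) ` ((*v) (cocycle A n x) ` e1 x)"
      by (simp add: image_image matrix_vector_mul_assoc)
    then show ?case using Suc e1_step[OF mather_set_funpow(1)[OF assms]] by (simp add: 0)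
  qed simp
  show "(*v) (cocycle A n x) ` e2 x = e2 ((left_shift ^^ n) x)"
  proof (induction n)
    case (Suc n)
    have "(*v) (cocycle A (Suc n) x) ` e2 x = (*v) (A (x (int n))) ` ((*v) (cocycle A n x) ` e2 x)"
      by (simp add: image_image matrix_vector_mul_assoc)
    then show ?case using Suc e2_step[OF mather_set_funpow(1)[OF assms]] by (simp add: 0)
  qed simp
qed

lemma dominated_vectors:
  assumes x: "x \<in> K" and n: "n \<ge> 1" and u: "u \<in> e1 x" and f: "f \<in> e2 x"
  shows "c * exp (\<delta> * real n) * norm (cocycle A n x *v f) * norm u \<le> norm (cocycle A n x *v u) * norm f"
proof -
  have "c * exp (\<delta> * real n) * norm_on (cocycle A n x) (e2 x) * (norm f * norm u)
      \<le> norm_on (cocycle A n x) (e1 x) * (norm f * norm u)"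
    using dominated[OF x n] by (intro mult_right_mono) auto
  then show ?thesis
    using norm_on_lines[OF e_lines(1)[OF x] u, of "cocycle A n x"]
      norm_on_lines[OF e_lines(2)[OF x] f, of "cocycle A n x"]
    by (simp add: mult.assoc mult.left_commute mult.commute)
qed

text \<open>The squared sine of the angle between the two directions is continuous and positive,
  hence bounded below on a compact set. The application is to the support of a single
  measure.\<close>

lemma uniformly_transversal:
  assumes S: "compact S" "S \<subseteq> K"
  obtains a where "a > 0"
    "\<And>x u f. x \<in> S \<Longrightarrow> u \<in> e1 x \<Longrightarrow> f \<in> e2 x \<Longrightarrow> a * (norm u * norm f) \<le> \<bar>wedge u f\<bar>"
proof (cases "S = {}")
  case True
  then show thesis using that[of 1] by simp
next
  case False
  \<comment> \<open>The quotient is an entry of the orthogonal projection onto \<open>L\<close>,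
    which does not depend on the vector representing \<open>L\<close>.\<close>
  have "\<exists>H. continuous_map projective_line euclideanreal H \<and>
      (\<forall>L v. L \<in> lines \<longrightarrow> v \<in> L \<longrightarrow> v \<noteq> 0 \<longrightarrow> H L = v $ i * v $ j / (norm v)\<^sup>2)" for i j
  proof (rule continuous_map_projective_line[of "\<lambda>v. v $ i * v $ j / (norm v)\<^sup>2"])
    show "continuous_on (- {0}) (\<lambda>v :: real^2. v $ i * v $ j / (norm v)\<^sup>2)"
      by (intro continuous_intros) auto
    show "(t *\<^sub>R v) $ i * (t *\<^sub>R v) $ j / (norm (t *\<^sub>R v))\<^sup>2 = v $ i * v $ j / (norm v)\<^sup>2"
      if "t \<noteq> 0" "v \<noteq> 0" for t and v :: "real^2"
    proof -
      have "(t *\<^sub>R v) $ i * (t *\<^sub>R v) $ j = t\<^sup>2 * (v $ i * v $ j)"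
        "(norm (t *\<^sub>R v))\<^sup>2 = t\<^sup>2 * (norm v)\<^sup>2"
        by (simp_all add: power_mult_distrib) (simp add: power2_eq_square)
      then show ?thesis using that by (simp only:) simp
    qed
  qed blast
  then obtain q where q: "\<And>i j. continuous_map projective_line euclideanreal (q i j)"
    "\<And>i j L v. L \<in> lines \<Longrightarrow> v \<in> L \<Longrightarrow> v \<noteq> 0 \<Longrightarrow> q i j L = v $ i * v $ j / (norm v)\<^sup>2"
    by metis
  \<comment> \<open>The squared sine in terms of the two projections, obtained by expanding the
    square of \<open>wedge u f\<close>.\<close>
  define G where "G x = q 1 1 (e1 x) * q 2 2 (e2 x) - 2 * q 1 2 (e1 x) * q 1 2 (e2 x)
    + q 2 2 (e1 x) * q 1 1 (e2 x)" for x
  have qe: "continuous_on S (\<lambda>x. q i j (e1 x))" "continuous_on S (\<lambda>x. q i j (e2 x))" for i j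
  proof -
    have "continuous_map (top_of_set K) euclideanreal (q i j \<circ> e1)"
      "continuous_map (top_of_set K) euclideanreal (q i j \<circ> e2)"
      using continuous_map_compose[OF e1_continuous q(1)] continuous_map_compose[OF e2_continuous q(1)]
      by auto
    then show "continuous_on S (\<lambda>x. q i j (e1 x))" "continuous_on S (\<lambda>x. q i j (e2 x))"
      using continuous_on_subset[OF _ S(2)] by (auto simp: comp_def)
  qed
  have "continuous_on S G" unfolding G_def by (intro continuous_intros qe)
  then obtain x0 where x0: "x0 \<in> S" "\<And>x. x \<in> S \<Longrightarrow> G x0 \<le> G x"
    using continuous_attains_inf[OF S(1) False] by blast
  have G: "G x = (wedge u f)\<^sup>2 / ((norm u)\<^sup>2 * (norm f)\<^sup>2)"
    if "x \<in> S" "u \<in> e1 x" "f \<in> e2 x" "u \<noteq> 0" "f \<noteq> 0" for x u f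
  proof -
    have xK: "x \<in> K" using that S by blast
    note q' = q(2)[OF e_lines(1)[OF xK] that(2,4)] q(2)[OF e_lines(2)[OF xK] that(3,5)]
    show ?thesis unfolding G_def q' using that(4,5)
      by (simp add: wedge_def divide_simps) (simp add: power2_eq_square algebra_simps)
  qed
  have x0K: "x0 \<in> K" using x0 S by blast
  obtain u0 f0 where uf0: "u0 \<in> e1 x0" "u0 \<noteq> 0" "f0 \<in> e2 x0" "f0 \<noteq> 0"
    using lines_obtain_nonzero e_lines[OF x0K] by metis
  have Gpos: "G x0 > 0"
    using wedge_transversal[OF x0K uf0(1,3,2,4)] uf0 by (simp add: G[OF x0(1) uf0(1,3,2,4)])
  show thesis
  proof (rule that[of "sqrt (G x0)"])
    show "sqrt (G x0) > 0" using Gpos by simp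
    fix x u f assume x: "x \<in> S" and uf: "u \<in> e1 x" "f \<in> e2 x"
    show "sqrt (G x0) * (norm u * norm f) \<le> \<bar>wedge u f\<bar>"
    proof (cases "u = 0 \<or> f = 0")
      case False
      then have "G x0 \<le> (wedge u f)\<^sup>2 / ((norm u)\<^sup>2 * (norm f)\<^sup>2)"
        using x0(2)[OF x] G[OF x uf] by simp
      then have "G x0 * (norm u * norm f)\<^sup>2 \<le> (wedge u f)\<^sup>2"
        using False by (simp add: field_simps power_mult_distrib)
      then have "sqrt (G x0 * (norm u * norm f)\<^sup>2) \<le> sqrt ((wedge u f)\<^sup>2)"
        by (rule real_sqrt_le_mono)
      then show ?thesis by (simp add: real_sqrt_mult)
    qed auto
  qed
qed

lemma N_cocycle_le:
  assumes "x \<in> Sigma_space k"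
  shows "N (cocycle A n x *v v) \<le> exp (real n * \<beta>) * N v"
proof (induction n)
  case (Suc n)
  have "N (cocycle A (Suc n) x *v v) = N (A (x (int n)) *v (cocycle A n x *v v))"
    by (simp add: matrix_vector_mul_assoc)
  also have "\<dots> \<le> exp \<beta> * N (cocycle A n x *v v)"
    using assms by (intro N_step) (auto simp: Sigma_space_def)
  also have "\<dots> \<le> exp \<beta> * (exp (real n * \<beta>) * N v)" using Suc by (intro mult_left_mono) auto
  also have "\<dots> = exp (real (Suc n) * \<beta>) * N v" by (simp add: exp_add[symmetric] algebra_simps)
  finally show ?case .
qed simp

text \<open>If \<open>N\<close> were strictly contracted, relative to \<open>exp \<beta>\<close>, at a point of the support, then it would be
  so by a factor \<open>exp (- \<epsilon>)\<close> on an open set \<open>U\<close> of positive measure; each visit to \<open>U\<close> then costs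
  \<open>\<epsilon>\<close>, so the exponent of the measure would be at most \<open>\<beta> - \<epsilon> \<mu>(U)\<close>.\<close>

lemma N_preserved_on_support:
  assumes M: "lyapunov_maximizing k A M" and x: "x \<in> measure_support M" and u: "u \<in> e1 x"
  shows "N (A (x 0) *v u) = exp \<beta> * N u"
proof (rule ccontr)
  assume ne: "N (A (x 0) *v u) \<noteq> exp \<beta> * N u"
  have inv: "invariant_prob_measure k M" and lyap: "lyapunov_exponent A M = \<beta>"
    using M by (auto simp: lyapunov_maximizing_def)
  have Ms: "sets M = sets (restrict_space borel (Sigma_space k))" and "prob_space M"
    using inv by (auto simp: invariant_prob_measure_def)
  interpret prob_space M by fact
  note sp = space_shift_measure[OF Ms]
  let ?S = "measure_support M"
  have SK: "?S \<subseteq> K" using M by (auto simp: mather_set_def)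
  have xK: "x \<in> K" using x SK by blast
  define i where "i = x 0"
  have i: "i \<in> {1..k}" using mather_set_symbol[OF xK] by (simp add: i_def)
  have u0: "u \<noteq> 0" using ne by auto
  have Au: "A i *v u \<noteq> 0" by (rule matrix_vector_mult_neq_0) (use SL2 i u0 in auto)
  define r where "r = N (A i *v u) / N u"
  have r: "0 < r" "r < exp \<beta>"
    using ne N_step[OF i, of u] N_pos[OF u0] N_pos[OF Au] by (auto simp: r_def i_def field_simps)
  \<comment> \<open>Half of the logarithmic gap: the inequality at \<open>u\<close> stays strict
    with \<open>\<beta> - \<epsilon>\<close>, and so persists nearby.\<close>
  define \<epsilon> where "\<epsilon> = (\<beta> - ln r) / 2"
  have lr: "ln r < \<beta>" using r by (metis ln_exp ln_less_cancel_iff exp_gt_zero)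
  then have \<epsilon>: "\<epsilon> > 0" by (simp add: \<epsilon>_def)
  have "ln r < \<beta> - \<epsilon>" using lr by (simp add: \<epsilon>_def field_simps)
  then have "r < exp (\<beta> - \<epsilon>)" using r by (metis exp_less_cancel_iff exp_ln)
  then have contr: "N (A i *v u) < exp (\<beta> - \<epsilon>) * N u"
    using N_pos[OF u0] by (simp add: r_def field_simps)
  define D where "D = {L \<in> lines. \<forall>v\<in>L. v \<noteq> 0 \<longrightarrow> N (A i *v v) < exp (\<beta> - \<epsilon>) * N v}"
  have D_iff: "L \<in> D \<longleftrightarrow> N (A i *v v) < exp (\<beta> - \<epsilon>) * N v"
    if L: "L \<in> lines" and v: "v \<in> L" "v \<noteq> 0" for L v
  proof
    assume lt: "N (A i *v v) < exp (\<beta> - \<epsilon>) * N v"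
    have "N (A i *v w) < exp (\<beta> - \<epsilon>) * N w" if w: "w \<in> L" "w \<noteq> 0" for w
    proof -
      obtain t where t: "w = t *\<^sub>R v" using w lines_eq_span[OF L v] by (auto simp: span_singleton)
      then have "\<bar>t\<bar> > 0" using w by auto
      then have "\<bar>t\<bar> * N (A i *v v) < \<bar>t\<bar> * (exp (\<beta> - \<epsilon>) * N v)" using lt by simp
      then show ?thesis by (simp add: t matrix_vector_mult_scaleR N_scale mult.left_commute)
    qed
    then show "L \<in> D" using L by (simp add: D_def)
  qed (use v in \<open>auto simp: D_def\<close>)
  have "openin projective_line D"
    unfolding openin_projective_line
  proof
    have "{v. v \<noteq> 0 \<and> span {v} \<in> D} = - {0} \<inter> {v. N (A i *v v) < exp (\<beta> - \<epsilon>) * N v}"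
    proof -
      have "span {v} \<in> D \<longleftrightarrow> N (A i *v v) < exp (\<beta> - \<epsilon>) * N v" if "v \<noteq> 0" for v
        using D_iff[OF span_singleton_in_lines[OF that] _ that] by (simp add: span_base)
      then show ?thesis by auto
    qed
    moreover have "continuous_on UNIV (\<lambda>v. N (A i *v v))"
      by (rule continuous_on_compose2[OF N_continuous matrix_vector_mult_linear_continuous_on subset_UNIV])
    then have "open {v. N (A i *v v) < exp (\<beta> - \<epsilon>) * N v}"
      by (intro open_Collect_less continuous_intros N_continuous)
    ultimately show "open {v. v \<noteq> 0 \<and> span {v} \<in> D}" by (simp add: open_Int open_Compl)
  qed (simp add: D_def)
  then have "openin (top_of_set K) {y \<in> K. e1 y \<in> D}"
    using openin_continuous_map_preimage[OF e1_continuous] by simp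
  then obtain U0 where U0: "open U0" "{y \<in> K. e1 y \<in> D} = K \<inter> U0"
    by (auto simp: openin_open)
  \<comment> \<open>Fixing the symbol at \<open>0\<close> makes \<open>A i\<close> the matrix that
    acts at every point of \<open>U\<close>.\<close>
  define U where "U = U0 \<inter> {y. y 0 \<in> {i}}"
  have U: "open U" unfolding U_def by (intro open_Int U0 open_Collect_coordinate)
  have "x \<in> {y \<in> K. e1 y \<in> D}" using xK D_iff[OF e_lines(1)[OF xK] u u0] contr by simp
  then have xU: "x \<in> U" using U0(2) by (auto simp: U_def i_def)
  have UD: "e1 y \<in> D" "y 0 = i" if "y \<in> K" "y \<in> U" for y
    using that U0(2) by (auto simp: U_def)
  have Us: "U \<inter> space M \<in> sets M"
    unfolding sets_shift_measure_iff[OF Ms] sp using U closed_Sigma_space by auto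
  define p where "p = measure M (U \<inter> space M)"
  have p: "p > 0"
    using x U xU by (auto simp: measure_support_def p_def emeasure_eq_measure)
  \<comment> \<open>The number of visits to \<open>U\<close> before time \<open>n\<close>.\<close>
  define V where "V n y = (\<Sum>j<n. indicator (U \<inter> space M) ((left_shift ^^ j) y) :: real)" for n y
  have N_decay: "N (cocycle A n y *v v) \<le> exp (real n * \<beta> - \<epsilon> * V n y) * N v"
    if y: "y \<in> K" and v: "v \<in> e1 y" for n y v
  proof (induction n)
    case (Suc n)
    let ?y = "(left_shift ^^ n) y" and ?w = "cocycle A n y *v v"
    have yK: "?y \<in> K" by (rule mather_set_funpow[OF y])
    have y0: "?y 0 = y (int n)" by (simp add: left_shift_funpow)
    have w: "?w \<in> e1 ?y" using cocycle_image_e(1)[OF y, of n] v by blast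
    have "N (A (?y 0) *v ?w) \<le> exp (\<beta> - \<epsilon> * indicator (U \<inter> space M) ?y) * N ?w"
    proof (cases "?y \<in> U \<and> ?w \<noteq> 0")
      case True
      then have "N (A i *v ?w) < exp (\<beta> - \<epsilon>) * N ?w"
        using UD(1)[OF yK] D_iff[OF e_lines(1)[OF yK] w] by blast
      then show ?thesis
        using UD(2)[OF yK] True mather_set_Sigma[OF yK] by (simp add: sp)
    next
      case False
      then show ?thesis
        using N_step[OF mather_set_symbol[OF yK], of 0 ?w] by (cases "?w = 0") auto
    qed
    also have "\<dots> \<le> exp (\<beta> - \<epsilon> * indicator (U \<inter> space M) ?y) * (exp (real n * \<beta> - \<epsilon> * V n y) * N v)"
      using Suc by (intro mult_left_mono) auto
    also have "\<dots> = exp (real (Suc n) * \<beta> - \<epsilon> * V (Suc n) y) * N v"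
      by (simp add: V_def exp_add[symmetric] algebra_simps)
    finally show ?case by (simp add: y0 matrix_vector_mul_assoc)
  qed (simp add: V_def)
  have "compact ?S"
    using compact_Int_closed[OF compact_Sigma_space measure_support_props(2)[OF inv]]
      measure_support_props(1)[OF inv] by (metis inf.absorb_iff2)
  then obtain a where a: "a > 0"
    "\<And>x u f. x \<in> ?S \<Longrightarrow> u \<in> e1 x \<Longrightarrow> f \<in> e2 x \<Longrightarrow> a * (norm u * norm f) \<le> \<bar>wedge u f\<bar>"
    using uniformly_transversal[OF _ SK] by blast
  \<comment> \<open>The coordinates of a vector \<open>v\<close> along unit vectors of
    \<open>e1\<close> and \<open>e2\<close> are at most \<open>norm v / a\<close>, and the images of
    these unit vectors are bounded by \<open>C\<close> and \<open>C / c\<close> times the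
    exponential.\<close>
  define B where "B = (1 + 1 / c) * C / a"
  have B: "B > 0" using c_pos a(1) C_ge_1 by (simp add: B_def add_pos_pos)
  have op: "op_norm (cocycle A n y) \<le> B * exp (real n * \<beta> - \<epsilon> * V n y)"
    if y: "y \<in> ?S" and n: "n \<ge> 1" for n y
  proof (rule onorm_le)
    fix v
    have yK: "y \<in> K" using y SK by blast
    let ?E = "exp (real n * \<beta> - \<epsilon> * V n y)"
    obtain u where u: "u \<in> e1 y" "norm u = 1" using lines_obtain_unit[OF e_lines(1)[OF yK]] .
    obtain f where f: "f \<in> e2 y" "norm f = 1" using lines_obtain_unit[OF e_lines(2)[OF yK]] .
    have w: "a \<le> \<bar>wedge u f\<bar>" using a(2)[OF y u(1) f(1)] u f by simp
    then have w0: "wedge u f \<noteq> 0" using a(1) by auto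
    have Au: "norm (cocycle A n y *v u) \<le> ?E * C"
    proof -
      have "norm (cocycle A n y *v u) \<le> ?E * N u"
        using norm_le_N N_decay[OF yK u(1), of n] order_trans by blast
      also have "\<dots> \<le> ?E * C" using N_le_norm[of u] u by (intro mult_left_mono) auto
      finally show ?thesis .
    qed
    have Af: "norm (cocycle A n y *v f) \<le> ?E * C / c"
    proof -
      have "c * exp (\<delta> * real n) * norm (cocycle A n y *v f) \<le> norm (cocycle A n y *v u)"
        using dominated_vectors[OF yK n u(1) f(1)] u f by simp
      moreover have "c * 1 * norm (cocycle A n y *v f) \<le> c * exp (\<delta> * real n) * norm (cocycle A n y *v f)"
        using c_pos \<delta>_pos by (intro mult_right_mono mult_left_mono) auto
      ultimately have "c * norm (cocycle A n y *v f) \<le> ?E * C" using Au by simp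
      then show ?thesis using c_pos by (simp add: field_simps)
    qed
    have co: "\<bar>wedge v f / wedge u f\<bar> \<le> norm v / a" "\<bar>wedge u v / wedge u f\<bar> \<le> norm v / a"
      using abs_wedge_le[of v f] abs_wedge_le[of u v] u f w a(1)
      by (auto simp: abs_divide intro!: frac_le)
    have "cocycle A n y *v v = (wedge v f / wedge u f) *\<^sub>R (cocycle A n y *v u)
        + (wedge u v / wedge u f) *\<^sub>R (cocycle A n y *v f)"
      by (subst wedge_decompose[OF w0, of v])
        (simp only: matrix_vector_right_distrib matrix_vector_mult_scaleR)
    then have "norm (cocycle A n y *v v) \<le> \<bar>wedge v f / wedge u f\<bar> * norm (cocycle A n y *v u)
        + \<bar>wedge u v / wedge u f\<bar> * norm (cocycle A n y *v f)"
      by (metis norm_triangle_ineq norm_scaleR)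
    also have "\<dots> \<le> norm v / a * (?E * C) + norm v / a * (?E * C / c)"
      using co Au Af a(1) by (intro add_mono mult_mono) auto
    also have "\<dots> = B * ?E * norm v" using a(1) c_pos by (simp add: B_def divide_simps) (simp add: algebra_simps)
    finally show "norm (cocycle A n y *v v) \<le> B * ?E * norm v" .
  qed
  have V_int: "integrable M (V n)" "(\<integral>y. V n y \<partial>M) = real n * p" for n
  proof -
    have I: "integrable M (indicator (U \<inter> space M) :: _ \<Rightarrow> real)"
      using Us by (simp add: integrable_indicator_iff emeasure_eq_measure)
    note I' = integral_shift[OF inv I]
    show "integrable M (V n)" unfolding V_def by (intro Bochner_Integration.integrable_sum I'(1))
    have "(\<integral>y. V n y \<partial>M) = (\<Sum>j<n. (\<integral>y. indicator (U \<inter> space M) ((left_shift ^^ j) y) \<partial>M))"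
      unfolding V_def by (rule Bochner_Integration.integral_sum) (rule I'(1))
    also have "\<dots> = real n * p" using I'(2) Us by (simp add: p_def)
    finally show "(\<integral>y. V n y \<partial>M) = real n * p" .
  qed
  \<comment> \<open>By invariance the mean of \<open>V n\<close> is \<open>n * p\<close>, so a bound
    independent of \<open>n\<close> contradicts \<open>p > 0\<close>.\<close>
  have bound: "\<epsilon> * (real n * p) \<le> ln B" if n: "n \<ge> 1" for n
  proof -
    have "real n * \<beta> \<le> (\<integral>y. ln (op_norm (cocycle A n y)) \<partial>M)"
      using lyapunov_exponent_le_integral[OF inv SL2] lyap by metis
    also have "\<dots> \<le> (\<integral>y. ln B + real n * \<beta> - \<epsilon> * V n y \<partial>M)"
    proof (rule integral_mono_AE[OF ln_op_norm_cocycle_integrable[OF inv SL2]])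
      show "integrable M (\<lambda>y. ln B + real n * \<beta> - \<epsilon> * V n y)" using V_int(1) by simp
      show "AE y in M. ln (op_norm (cocycle A n y)) \<le> ln B + real n * \<beta> - \<epsilon> * V n y"
      proof (rule AE_I'[OF measure_support_props(3)[OF inv]], rule subsetI, rule ccontr)
        fix y assume y: "y \<in> {y \<in> space M. \<not> ln (op_norm (cocycle A n y)) \<le> ln B + real n * \<beta> - \<epsilon> * V n y}"
          and "y \<notin> Sigma_space k - ?S"
        then have yS: "y \<in> ?S" "y \<in> Sigma_space k" by (auto simp: sp)
        have "ln (op_norm (cocycle A n y)) \<le> ln (B * exp (real n * \<beta> - \<epsilon> * V n y))"
          using op[OF yS(1) n] op_norm_ge_1[OF det_cocycle[OF SL2 yS(2)], of n] by (intro ln_mono) auto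
        also have "\<dots> = ln B + real n * \<beta> - \<epsilon> * V n y" using B by (subst ln_mult_pos) auto
        finally show False using y by simp
      qed
    qed
    also have "\<dots> = ln B + real n * \<beta> - \<epsilon> * (real n * p)"
      using V_int by (simp add: prob_space)
    finally show ?thesis by simp
  qed
  obtain n :: nat where n: "ln B / (\<epsilon> * p) < real n" using reals_Archimedean2 by blast
  have "ln B / (\<epsilon> * p) < real (Suc n)" using n by simp
  then have "ln B < \<epsilon> * (real (Suc n) * p)" using \<epsilon> p by (simp add: field_simps del: of_nat_Suc)
  then show False using bound[of "Suc n"] by simp
qed

lemma N_preserved:
  assumes x: "x \<in> K" and u: "u \<in> e1 x"
  shows "N (cocycle A n x *v u) = exp (real n * \<beta>) * N u"
proof (induction n)
  case (Suc n)
  let ?y = "(left_shift ^^ n) x" and ?w = "cocycle A n x *v u"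
  have yK: "?y \<in> K" by (rule mather_set_funpow[OF x])
  have w: "?w \<in> e1 ?y" using cocycle_image_e(1)[OF x, of n] u by blast
  have "N (A (?y 0) *v ?w) = exp \<beta> * N ?w"
    using mather_setE[OF yK] N_preserved_on_support w by metis
  then show ?case using Suc
    by (simp add: left_shift_funpow matrix_vector_mul_assoc exp_add[symmetric] algebra_simps)
qed simp

end

section \<open>Directions and futures of a common past\<close>

context extremal_splitting
begin

text \<open>Any factor above \<open>1\<close> would do instead of \<open>2\<close>: two distinct candidates for the direction \<open>e1\<close>
  of a common past would each be contracted backwards relative to the other.\<close>

lemma backward_contraction:
  assumes x: "x \<in> K" and u: "u \<in> e1 x" "u \<noteq> 0" and w: "w \<notin> e1 x"
  shows "eventually (\<lambda>n. \<forall>u' w'. cocycle A n ((right_shift ^^ n) x) *v u' = u \<longrightarrow>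
    cocycle A n ((right_shift ^^ n) x) *v w' = w \<longrightarrow> 2 * norm u' \<le> norm w') sequentially"
proof -
  obtain f where f: "f \<in> e2 x" "f \<noteq> 0" using lines_obtain_nonzero[OF e_lines(2)[OF x]] .
  have uf: "wedge u f \<noteq> 0" by (rule wedge_transversal[OF x u(1) f(1) u(2) f(2)])
  define a where "a = wedge w f / wedge u f"
  define b where "b = wedge u w / wedge u f"
  have wab: "w = a *\<^sub>R u + b *\<^sub>R f" unfolding a_def b_def by (rule wedge_decompose[OF uf])
  have b: "b \<noteq> 0"
  proof
    assume "b = 0"
    then have "w \<in> e1 x" using wab lines_scale[OF e_lines(1)[OF x] u(1)] by simp
    then show False using w by simp
  qed
  \<comment> \<open>Domination read backwards: \<open>q n\<close> bounds the ratio of the norms of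
    the preimages \<open>u1\<close> and \<open>f1\<close> of \<open>u\<close> and
    \<open>f\<close>.\<close>
  define q where "q n = exp (- (\<delta> * real n)) * (norm u / (norm f * c))" for n
  have "q \<longlonglongrightarrow> 0 * (norm u / (norm f * c))"
    unfolding q_def
  proof (intro tendsto_mult tendsto_const)
    have "(\<lambda>n. exp (- \<delta>) ^ n) \<longlonglongrightarrow> 0" using \<delta>_pos by (intro LIMSEQ_power_zero) auto
    moreover have "exp (- \<delta>) ^ n = exp (- (\<delta> * real n))" for n
      by (simp add: exp_of_nat_mult[symmetric] mult.commute)
    ultimately show "(\<lambda>n. exp (- (\<delta> * real n))) \<longlonglongrightarrow> 0" by simp
  qed
  then have "q \<longlonglongrightarrow> 0" by simp
  \<comment> \<open>With this threshold, \<open>norm w' \<ge> \<bar>b\<bar> * norm f1 -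
    \<bar>a\<bar> * norm u1 \<ge> 2 * norm u1\<close>.\<close>
  moreover have "0 < \<bar>b\<bar> / (2 + \<bar>a\<bar>)" using b by (simp add: add_pos_nonneg)
  ultimately have "eventually (\<lambda>n. q n < \<bar>b\<bar> / (2 + \<bar>a\<bar>)) sequentially"
    by (rule order_tendstoD)
  then show ?thesis
    using eventually_ge_at_top[of 1]
  proof eventually_elim
    case (elim n)
    let ?y = "(right_shift ^^ n) x"
    let ?B = "cocycle A n ?y"
    have yK: "?y \<in> K" by (rule mather_set_funpow[OF x])
    have yx: "(left_shift ^^ n) ?y = x" by (simp add: left_shift_funpow right_shift_funpow)
    have det: "det ?B = 1" by (rule det_cocycle[OF SL2 mather_set_Sigma[OF yK]])
    obtain u1 where u1: "u1 \<in> e1 ?y" "?B *v u1 = u"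
      using cocycle_image_e(1)[OF yK, of n] u(1) yx by (metis imageE)
    obtain f1 where f1: "f1 \<in> e2 ?y" "?B *v f1 = f"
      using cocycle_image_e(2)[OF yK, of n] f(1) yx by (metis imageE)
    have inj: "v = v'" if "?B *v v = ?B *v v'" for v v'
    proof (rule ccontr)
      assume "v \<noteq> v'"
      then have "?B *v (v - v') \<noteq> 0" by (intro matrix_vector_mult_neq_0[OF det]) simp
      then show False using that by (simp add: matrix_vector_mult_diff_distrib)
    qed
    have "c * exp (\<delta> * real n) * norm f * norm u1 \<le> norm u * norm f1"
      using dominated_vectors[OF yK elim(2) u1(1) f1(1)] u1 f1 by simp
    then have q: "norm u1 \<le> q n * norm f1"
      using c_pos f(2) by (simp add: q_def exp_minus field_simps)
    show ?case
    proof (intro allI impI)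
      fix u' w' assume u': "?B *v u' = u" and w': "?B *v w' = w"
      have uu: "u' = u1" by (rule inj) (simp add: u' u1)
      have "w' = a *\<^sub>R u1 + b *\<^sub>R f1"
        by (rule inj) (simp add: w' wab matrix_vector_right_distrib matrix_vector_mult_scaleR u1 f1)
      then have "norm (b *\<^sub>R f1) \<le> norm w' + norm (a *\<^sub>R u1)"
        using norm_triangle_ineq4[of w' "a *\<^sub>R u1"] by simp
      then have 1: "\<bar>b\<bar> * norm f1 \<le> norm w' + \<bar>a\<bar> * norm u1" by simp
      have "q n * norm f1 \<le> \<bar>b\<bar> / (2 + \<bar>a\<bar>) * norm f1"
        using elim(1) by (intro mult_right_mono) auto
      then have "(2 + \<bar>a\<bar>) * norm u1 \<le> (2 + \<bar>a\<bar>) * (\<bar>b\<bar> / (2 + \<bar>a\<bar>) * norm f1)"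
        using q by (intro mult_left_mono) linarith+
      also have "\<dots> = \<bar>b\<bar> * norm f1" by (simp add: add_pos_nonneg less_imp_neq[symmetric])
      finally have "2 * norm u1 + \<bar>a\<bar> * norm u1 \<le> \<bar>b\<bar> * norm f1" by (simp add: algebra_simps)
      then show "2 * norm u' \<le> norm w'" unfolding uu using 1 by linarith
    qed
  qed
qed

lemma cocycle_cong: "(\<And>i. i < n \<Longrightarrow> x (int i) = y (int i)) \<Longrightarrow> cocycle A n x = cocycle A n y"
  by (induction n) auto

text \<open>Independence of the future is not part of \<open>dominated_splitting\<close>. It follows
  from domination, since both directions are tested against the same backward matrices.\<close>

lemma e1_past:
  assumes x: "x \<in> K" and y: "y \<in> K" and past: "\<forall>l<0. x l = y l"
  shows "e1 x = e1 y"
proof (rule ccontr)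
  assume ne: "e1 x \<noteq> e1 y"
  obtain u where u: "u \<in> e1 x" "u \<noteq> 0" using lines_obtain_nonzero[OF e_lines(1)[OF x]] .
  obtain v where v: "v \<in> e1 y" "v \<noteq> 0" using lines_obtain_nonzero[OF e_lines(1)[OF y]] .
  have nu: "u \<notin> e1 y" and nv: "v \<notin> e1 x"
    using ne lines_eq_span[OF e_lines(1)[OF x] _ u(2)] lines_eq_span[OF e_lines(1)[OF y] _ u(2)]
      lines_eq_span[OF e_lines(1)[OF x] _ v(2)] lines_eq_span[OF e_lines(1)[OF y] _ v(2)] u(1) v(1)
    by metis+
  \<comment> \<open>Both matrices read only the coordinates from \<open>- n\<close> to
    \<open>- 1\<close>, where the points agree.\<close>
  have eq: "cocycle A n ((right_shift ^^ n) x) = cocycle A n ((right_shift ^^ n) y)" for n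
    by (rule cocycle_cong) (use past in \<open>simp add: right_shift_funpow\<close>)
  obtain n where n: "\<forall>u' w'. cocycle A n ((right_shift ^^ n) x) *v u' = u \<longrightarrow>
      cocycle A n ((right_shift ^^ n) x) *v w' = v \<longrightarrow> 2 * norm u' \<le> norm w'"
    "\<forall>u' w'. cocycle A n ((right_shift ^^ n) y) *v u' = v \<longrightarrow>
      cocycle A n ((right_shift ^^ n) y) *v w' = u \<longrightarrow> 2 * norm u' \<le> norm w'"
    using eventually_happens'[OF sequentially_bot
        eventually_conj[OF backward_contraction[OF x u nv] backward_contraction[OF y v nu]]]
    by blast
  let ?B = "cocycle A n ((right_shift ^^ n) x)"
  have "(left_shift ^^ n) ((right_shift ^^ n) x) = x" "(left_shift ^^ n) ((right_shift ^^ n) y) = y"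
    by (simp_all add: left_shift_funpow right_shift_funpow)
  then obtain u' v' where uv: "?B *v u' = u" "?B *v v' = v"
    using cocycle_image_e(1)[OF mather_set_funpow(2)[OF x], of n n] u(1)
      cocycle_image_e(1)[OF mather_set_funpow(2)[OF y], of n n] v(1) eq[of n] by (metis imageE)
  have "2 * norm u' \<le> norm v'" "2 * norm v' \<le> norm u'"
    using n uv by (auto simp: eq)
  then have "norm u' = 0" using norm_ge_zero[of u'] norm_ge_zero[of v'] by linarith
  then show False using uv u(2) by simp
qed

text \<open>Follow the future of \<open>y\<close> from the direction \<open>e1 x\<close>: the component along \<open>e1 y\<close> dominates and is
  stretched by exactly \<open>exp (n \<beta>)\<close>, while \<open>N u\<close> grows at most by this factor.\<close>

lemma wedge_inequality:
  assumes x: "x \<in> K" and y: "y \<in> K" and u: "u \<in> e1 x" and v: "v \<in> e1 y" and g: "g \<in> e2 y"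
  shows "\<bar>wedge u g\<bar> * N v \<le> \<bar>wedge v g\<bar> * N u"
proof (cases "v = 0 \<or> g = 0")
  case False
  then have v0: "v \<noteq> 0" and g0: "g \<noteq> 0" by auto
  have vg: "wedge v g \<noteq> 0" by (rule wedge_transversal[OF y v g v0 g0])
  define a where "a = wedge u g / wedge v g"
  define b where "b = wedge v u / wedge v g"
  have uab: "u = a *\<^sub>R v + b *\<^sub>R g" unfolding a_def b_def by (rule wedge_decompose[OF vg])
  \<comment> \<open>\<open>D * exp (- \<delta>) ^ n\<close> bounds the \<open>N\<close>-norm of the
    component along \<open>g\<close> after \<open>n\<close> steps, divided by
    \<open>exp (n * \<beta>)\<close>. It combines domination with the exact growth along
    \<open>v\<close>.\<close>
  define D where "D = \<bar>b\<bar> * C * N v * norm g / (c * norm v)"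
  have le: "\<bar>a\<bar> * N v \<le> N u + D * exp (- \<delta>) ^ n" if n: "n \<ge> 1" for n
  proof -
    let ?B = "cocycle A n y" and ?E = "exp (real n * \<beta>)"
    have Nv: "N (?B *v v) = ?E * N v" by (rule N_preserved[OF y v])
    have "a *\<^sub>R (?B *v v) = ?B *v u + (- b) *\<^sub>R (?B *v g)"
      by (simp add: uab matrix_vector_right_distrib matrix_vector_mult_scaleR)
    then have "N (a *\<^sub>R (?B *v v)) \<le> N (?B *v u) + N ((- b) *\<^sub>R (?B *v g))"
      by (simp only: N_add)
    then have "\<bar>a\<bar> * (?E * N v) \<le> N (?B *v u) + \<bar>b\<bar> * N (?B *v g)"
      by (simp only: N_scale Nv abs_minus_cancel)
    also have "\<dots> \<le> ?E * N u + \<bar>b\<bar> * (C * norm (?B *v g))"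
      by (intro add_mono mult_left_mono N_le_norm N_cocycle_le mather_set_Sigma y) auto
    also have "norm (?B *v g) \<le> ?E * N v * norm g / (c * norm v) * exp (- \<delta>) ^ n"
    proof -
      have "c * exp (\<delta> * real n) * norm (?B *v g) * norm v \<le> norm (?B *v v) * norm g"
        by (rule dominated_vectors[OF y n v g])
      also have "\<dots> \<le> (?E * N v) * norm g"
        using norm_le_N[of "?B *v v"] Nv by (intro mult_right_mono) auto
      finally have "norm (?B *v g) \<le> ?E * N v * norm g / (c * norm v) * exp (- (\<delta> * real n))"
        using c_pos v0 by (simp add: exp_minus field_simps)
      moreover have "exp (- \<delta>) ^ n = exp (- (\<delta> * real n))"
        by (simp add: exp_of_nat_mult[symmetric] mult.commute)
      ultimately show ?thesis by simp
    qed
    finally have "\<bar>a\<bar> * (?E * N v) \<le> ?E * N u + \<bar>b\<bar> * (C * (?E * N v * norm g / (c * norm v) * exp (- \<delta>) ^ n))"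
      using C_ge_1 by (simp add: mult_left_mono)
    then have "?E * (\<bar>a\<bar> * N v) \<le> ?E * (N u + D * exp (- \<delta>) ^ n)"
      by (simp add: D_def algebra_simps)
    then show ?thesis by simp
  qed
  have "(\<lambda>n. N u + D * exp (- \<delta>) ^ n) \<longlonglongrightarrow> N u + D * 0"
    using \<delta>_pos by (intro tendsto_intros LIMSEQ_power_zero) auto
  then have "\<bar>a\<bar> * N v \<le> N u + D * 0"
    by (rule LIMSEQ_le_const) (use le in blast)
  then show ?thesis using vg by (simp add: a_def abs_divide field_simps)
qed auto

text \<open>Padding by \<open>0\<close>, which is not a symbol, keeps pasts in the type of points
  and makes agreement of pasts an equality.\<close>

definition past :: "(int \<Rightarrow> nat) \<Rightarrow> (int \<Rightarrow> nat)" where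
  "past x = (\<lambda>l. if l < 0 then x l else 0)"

lemma past_eq_iff: "past x = past y \<longleftrightarrow> (\<forall>l<0. x l = y l)"
  by (auto simp: past_def fun_eq_iff)

definition branching_pasts :: "(int \<Rightarrow> nat) set" where
  "branching_pasts = {past x | x. x \<in> K \<and> (\<exists>y\<in>K. past y = past x \<and> y \<noteq> x)}"

text \<open>Two futures of a common past span, in \<open>\<real>\<^sup>2\<close>, an open cone on which \<open>\<bar>wedge u w\<bar>\<close>, for the
  \<open>N\<close>-unit vector \<open>u\<close> of the common direction \<open>e1\<close>, dominates the corresponding quantity of every
  other past. Hence the cones of different pasts are disjoint, and there are only countably many.\<close>

lemma countable_branching_pasts:
  assumes e1_inj: "\<And>x y. x \<in> K \<Longrightarrow> y \<in> K \<Longrightarrow> e1 x = e1 y \<Longrightarrow> (\<forall>l<0. x l = y l)"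
    and e2_inj: "\<And>x y. x \<in> K \<Longrightarrow> y \<in> K \<Longrightarrow> e2 x = e2 y \<Longrightarrow> (\<forall>l\<ge>0. x l = y l)"
  shows "countable branching_pasts"
proof -
  \<comment> \<open>The signs of \<open>f\<close> and \<open>g\<close> are fixed so that on the cone
    between them \<open>\<bar>wedge u w\<bar>\<close> is \<open>wedge u w\<close>, a linear function
    of \<open>w\<close>. Normalizing \<open>N u = 1\<close> removes the norms from
    \<open>wedge_inequality\<close>.\<close>
  define good where "good a x y u f g \<longleftrightarrow> x \<in> K \<and> y \<in> K \<and> past x = a \<and> past y = a \<and>
    u \<in> e1 x \<and> u \<in> e1 y \<and> N u = 1 \<and> f \<in> e2 x \<and> g \<in> e2 y \<and>
    wedge u f > 0 \<and> wedge u g > 0 \<and> wedge f g \<noteq> 0" for a x y u f g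
  have "\<exists>x y u f g. good a x y u f g" if a: "a \<in> branching_pasts" for a
  proof -
    obtain x y where xy: "x \<in> K" "y \<in> K" "past x = a" "past y = a" "y \<noteq> x"
      using a by (auto simp: branching_pasts_def)
    have pa: "\<forall>l<0. x l = y l" using xy past_eq_iff by metis
    have e1: "e1 x = e1 y" by (rule e1_past[OF xy(1,2) pa])
    obtain u0 where u0: "u0 \<in> e1 x" "u0 \<noteq> 0" using lines_obtain_nonzero[OF e_lines(1)[OF xy(1)]] .
    define u where "u = (1 / N u0) *\<^sub>R u0"
    have u: "u \<in> e1 x" "N u = 1" "u \<noteq> 0"
      using u0 N_pos[OF u0(2)] lines_scale[OF e_lines(1)[OF xy(1)] u0(1)] by (auto simp: u_def N_scale)
    have pos: "\<exists>f\<in>e2 z. wedge u f > 0" if z: "z \<in> K" "u \<in> e1 z" for z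
    proof -
      obtain f where f: "f \<in> e2 z" "f \<noteq> 0" using lines_obtain_nonzero[OF e_lines(2)[OF z(1)]] .
      have "wedge u f \<noteq> 0" by (rule wedge_transversal[OF z(1,2) f(1) u(3) f(2)])
      \<comment> \<open>Multiplying \<open>f\<close> by \<open>wedge u f\<close> turns the wedge
        into a square.\<close>
      then have "wedge u (wedge u f *\<^sub>R f) > 0" by (auto simp: zero_less_mult_iff linorder_neq_iff)
      moreover have "wedge u f *\<^sub>R f \<in> e2 z" by (rule lines_scale[OF e_lines(2)[OF z(1)] f(1)])
      ultimately show ?thesis by blast
    qed
    obtain f where f: "f \<in> e2 x" "wedge u f > 0" using pos xy(1) u(1) by blast
    obtain g where g: "g \<in> e2 y" "wedge u g > 0" using pos[OF xy(2)] u(1) e1 by blast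
    have "wedge f g \<noteq> 0"
    proof
      assume 0: "wedge f g = 0"
      have fg0: "f \<noteq> 0" "g \<noteq> 0" using f g by auto
      have "g \<in> e2 x"
        using 0 wedge_eq_0_iff[OF fg0(1)] lines_eq_span[OF e_lines(2)[OF xy(1)] f(1) fg0(1)] by simp
      then have "e2 x = e2 y"
        using lines_eq_span[OF e_lines(2)[OF xy(1)] _ fg0(2)] lines_eq_span[OF e_lines(2)[OF xy(2)] g(1) fg0(2)]
        by simp
      then have "\<forall>l\<ge>0. x l = y l" by (rule e2_inj[OF xy(1,2)])
      then have "x = y" using pa by (metis ext linorder_not_less)
      then show False using xy(5) by simp
    qed
    then have "good a x y u f g" using xy u e1 f g by (simp add: good_def)
    then show ?thesis by blast
  qed
  then obtain X Y U F G where good: "\<And>a. a \<in> branching_pasts \<Longrightarrow> good a (X a) (Y a) (U a) (F a) (G a)"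
    by metis
  \<comment> \<open>By Cramer's rule these are the combinations of \<open>F a\<close> and
    \<open>G a\<close> with positive coefficients; the products avoid dividing by a determinant of
    unknown sign.\<close>
  define cone where "cone a = {w. wedge w (G a) * wedge (F a) (G a) > 0 \<and> wedge (F a) w * wedge (F a) (G a) > 0}"
    for a
  have cone_open: "open (cone a)" for a
    unfolding cone_def wedge_def
    by (intro open_Collect_conj open_Collect_less continuous_intros)
  have cone_nonempty: "F a + G a \<in> cone a" if "a \<in> branching_pasts" for a
    using good[OF that] by (auto simp: cone_def good_def zero_less_mult_iff linorder_neq_iff)
  have dom: "\<bar>wedge (U b) (F a)\<bar> \<le> wedge (U a) (F a)" "\<bar>wedge (U b) (G a)\<bar> \<le> wedge (U a) (G a)"
    if "a \<in> branching_pasts" "b \<in> branching_pasts" for a b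
    using good[OF that(1)] good[OF that(2)]
      wedge_inequality[of "X b" "X a" "U b" "U a" "F a"] wedge_inequality[of "X b" "Y a" "U b" "U a" "G a"]
    by (auto simp: good_def)
  have coords: "\<exists>s t. s > 0 \<and> t > 0 \<and> w = s *\<^sub>R F a + t *\<^sub>R G a"
    if a: "a \<in> branching_pasts" and w: "w \<in> cone a" for a w
  proof -
    have fg: "wedge (F a) (G a) \<noteq> 0" using good[OF a] by (simp add: good_def)
    have "wedge w (G a) / wedge (F a) (G a) > 0" "wedge (F a) w / wedge (F a) (G a) > 0"
      using w by (auto simp: cone_def zero_less_mult_iff zero_less_divide_iff)
    then show ?thesis using wedge_decompose[OF fg, of w] by blast
  qed
  have dom_cone: "\<bar>wedge (U b) w\<bar> \<le> wedge (U a) w"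
    if a: "a \<in> branching_pasts" and b: "b \<in> branching_pasts" and w: "w \<in> cone a" for a b w
  proof -
    obtain s t where st: "s > 0" "t > 0" "w = s *\<^sub>R F a + t *\<^sub>R G a" using coords[OF a w] by blast
    have "\<bar>wedge (U b) w\<bar> \<le> s * \<bar>wedge (U b) (F a)\<bar> + t * \<bar>wedge (U b) (G a)\<bar>"
      using st abs_triangle_ineq[of "s * wedge (U b) (F a)" "t * wedge (U b) (G a)"] by (simp add: abs_mult)
    also have "\<dots> \<le> s * wedge (U a) (F a) + t * wedge (U a) (G a)"
      using st dom[OF a b] by (intro add_mono mult_left_mono) auto
    finally show ?thesis using st by simp
  qed
  have eq: "a = b" if a: "a \<in> branching_pasts" and b: "b \<in> branching_pasts"
    and w: "w \<in> cone a" "w \<in> cone b" for a b w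
  proof -
    \<comment> \<open>At a common point both values are maximal, hence equal. Positivity of the
      coordinates then forces equality on \<open>F a\<close> and on \<open>G a\<close> separately,
      so \<open>U a = U b\<close>.\<close>
    have e: "wedge (U a) w = wedge (U b) w"
      using dom_cone[OF a b w(1)] dom_cone[OF b a w(2)] by linarith
    obtain s t where st: "s > 0" "t > 0" "w = s *\<^sub>R F a + t *\<^sub>R G a" using coords[OF a w(1)] by blast
    have "s * wedge (U b - U a) (F a) + t * wedge (U b - U a) (G a) = 0"
      using e st(3) by (simp add: algebra_simps)
    moreover have "s * wedge (U b - U a) (F a) \<le> 0" "t * wedge (U b - U a) (G a) \<le> 0"
      using dom[OF a b] st by (auto intro!: mult_nonneg_nonpos)
    ultimately have "s * wedge (U b - U a) (F a) = 0" "t * wedge (U b - U a) (G a) = 0" by linarith+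
    then have 0: "wedge (U b - U a) (F a) = 0" "wedge (U b - U a) (G a) = 0" using st by auto
    have fg: "wedge (F a) (G a) \<noteq> 0" using good[OF a] by (simp add: good_def)
    have "U b - U a = 0"
      by (subst wedge_decompose[OF fg, of "U b - U a"]) (use 0 wedge_swap[of "U b - U a" "F a"] in simp)
    then have U: "U a = U b" by simp
    have U0: "U a \<noteq> 0" using good[OF a] by (auto simp: good_def)
    have "e1 (X a) = e1 (X b)"
      using good[OF a] good[OF b] U U0 lines_eq_span[OF e_lines(1), of "X a" "U a"]
        lines_eq_span[OF e_lines(1), of "X b" "U a"] by (simp add: good_def)
    then have "past (X a) = past (X b)"
      unfolding past_eq_iff using e1_inj good[OF a] good[OF b] by (simp add: good_def)
    then show ?thesis using good[OF a] good[OF b] by (simp add: good_def)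
  qed
  have "countable (cone ` branching_pasts)"
  proof (rule countable_disjoint_open_subsets)
    show "disjoint (cone ` branching_pasts)"
      unfolding disjoint_def using eq by (auto; metis)
  qed (use cone_open in auto)
  moreover have "inj_on cone branching_pasts"
  proof (rule inj_onI)
    fix a b assume ab: "a \<in> branching_pasts" "b \<in> branching_pasts" "cone a = cone b"
    then show "a = b" using eq[OF ab(1,2) cone_nonempty[OF ab(1)]] cone_nonempty[OF ab(1)] by simp
  qed
  ultimately show ?thesis by (rule countable_image_inj_on)
qed

end

section \<open>Zero entropy\<close>

text \<open>The preimages of \<open>W\<close> are pairwise disjoint and of equal measure; total mass
  one holds \<open>n\<close> of them for every \<open>n\<close> only if that measure is
  \<open>0\<close>.\<close>

lemma wandering_set_null:
  assumes M: "invariant_prob_measure k M" and W: "W \<in> sets M"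
    and wander: "\<And>x n. x \<in> W \<Longrightarrow> n \<ge> 1 \<Longrightarrow> (left_shift ^^ n) x \<notin> W"
  shows "W \<in> null_sets M"
proof -
  have Ms: "sets M = sets (restrict_space borel (Sigma_space k))" and "prob_space M"
    using M by (auto simp: invariant_prob_measure_def)
  interpret prob_space M by fact
  define B where "B i = (left_shift ^^ i) -` W \<inter> space M" for i
  have B: "B i \<in> sets M" for i
    unfolding B_def by (rule measurable_sets[OF measurable_left_shift_funpow[OF Ms] W])
  have Bm: "measure M (B i) = measure M W" for i
    using measure_distr[OF measurable_left_shift_funpow[OF Ms] W, of i]
    by (simp add: B_def invariant_prob_measure_funpow[OF M])
  have disj: "B i \<inter> B j = {}" if "i < j" for i j
  proof (rule equals0I)
    fix x assume x: "x \<in> B i \<inter> B j"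
    have "(left_shift ^^ (j - i)) ((left_shift ^^ i) x) = (left_shift ^^ j) x"
      using that by (simp add: left_shift_funpow)
    moreover have "j - i \<ge> 1" using that by simp
    ultimately show False using x wander[of "(left_shift ^^ i) x" "j - i"] by (auto simp: B_def)
  qed
  have "real n * measure M W \<le> 1" for n
  proof -
    have "disjoint_family_on B {..<n}"
      unfolding disjoint_family_on_def using disj by (metis Int_commute linorder_neqE_nat)
    then have "measure M (\<Union>i<n. B i) = (\<Sum>i<n. measure M (B i))"
      by (intro finite_measure_finite_Union) (use B in auto)
    then have "real n * measure M W = measure M (\<Union>i<n. B i)" by (simp add: Bm)
    then show ?thesis by simp
  qed
  then have "measure M W = 0"
    by (metis ex_less_of_nat_mult linorder_not_le measure_nonneg less_eq_real_def)
  then show ?thesis using W by (auto simp: emeasure_eq_measure)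
qed

context extremal_splitting
begin

lemma closed_Collect_past: "closed {x. past ((left_shift ^^ n) x) = a}"
proof -
  have "{x. past ((left_shift ^^ n) x) = a} = {x. \<forall>l. if l < 0 then x (l + int n) \<in> {a l} else a l = 0}"
    by (auto simp: past_def left_shift_funpow fun_eq_iff split: if_splits)
  moreover have "closed {x :: int \<Rightarrow> nat. if l < 0 then x (l + int n) \<in> {a l} else a l = 0}" for l
    using closed_Collect_coordinate[of "l + int n" "{a l}"] by (cases "l < 0") auto
  ultimately show ?thesis by (simp only: closed_Collect_all)
qed

text \<open>Almost every point with a given past \<open>a\<close> returns to that past by Poincare recurrence; then \<open>a\<close> is
  periodic, and its period determines the next symbol. So the countably many branching pasts
  cause no loss.\<close>

lemma past_determines_next_symbol:
  assumes M: "lyapunov_maximizing k A M"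
    and countable: "countable branching_pasts"
  obtains Z where "Z \<in> null_sets M"
    "\<And>x y. x \<in> space M - Z \<Longrightarrow> y \<in> space M - Z \<Longrightarrow> (\<forall>l<0. x l = y l) \<Longrightarrow> x 0 = y 0"
proof -
  have inv: "invariant_prob_measure k M" using M by (auto simp: lyapunov_maximizing_def)
  have Ms: "sets M = sets (restrict_space borel (Sigma_space k))"
    using inv by (auto simp: invariant_prob_measure_def)
  note sp = space_shift_measure[OF Ms]
  define R where "R a n = {x. past ((left_shift ^^ n) x) = a}" for a n
  \<comment> \<open>The points with past \<open>a\<close> that never return to it: a wandering
    set.\<close>
  define W where "W a = Sigma_space k \<inter> R a 0 - (\<Union>n\<in>{1..}. R a n)" for a
  have W_null: "W a \<in> null_sets M" for a
  proof (rule wandering_set_null[OF inv])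
    have "R a n \<in> sets borel" for n
      unfolding R_def using closed_Collect_past by (rule borel_closed)
    then have "W a \<in> sets borel"
      unfolding W_def using borel_closed[OF closed_Sigma_space]
      by (intro sets.Diff sets.Int sets.countable_UN') auto
    then show "W a \<in> sets M" unfolding sets_shift_measure_iff[OF Ms] by (auto simp: W_def)
    show "(left_shift ^^ n) x \<notin> W a" if "x \<in> W a" "n \<ge> 1" for x n
      using that by (auto simp: W_def R_def)
  qed
  define Z where "Z = (Sigma_space k - measure_support M) \<union> (\<Union>a\<in>branching_pasts. W a)"
  show thesis
  proof (rule that[of Z])
    show "Z \<in> null_sets M"
      unfolding Z_def by (intro null_sets.Un measure_support_props(3)[OF inv] null_sets_UN' countable W_null)
    fix x y assume xZ: "x \<in> space M - Z" and yZ: "y \<in> space M - Z" and eq: "\<forall>l<0. x l = y l"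
    have K: "x \<in> K" "y \<in> K" using xZ yZ M by (auto simp: Z_def sp mather_set_def)
    have p: "past x = past y" using eq past_eq_iff by blast
    show "x 0 = y 0"
    proof (cases "past x \<in> branching_pasts")
      case True
      have ret: "\<exists>n\<ge>1. past ((left_shift ^^ n) z) = past z"
        if "z \<in> space M - Z" "past z = past x" for z
        using that True by (auto simp: Z_def W_def R_def sp)
      obtain n where n: "n \<ge> 1" "past ((left_shift ^^ n) x) = past x" using ret[OF xZ] by auto
      obtain m where m: "m \<ge> 1" "past ((left_shift ^^ m) y) = past y" using ret[OF yZ] p by auto
      have x: "x (l + int n) = x l" if "l < 0" for l
        using n(2) that by (simp add: past_eq_iff left_shift_funpow)
      have y: "y (l + int m) = y l" if "l < 0" for l
        using m(2) that by (simp add: past_eq_iff left_shift_funpow)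
      \<comment> \<open>The return times \<open>n\<close> and \<open>m\<close> may differ. Both
        symbols are traced back to the position \<open>- n - m\<close> of the common past.\<close>
      have "x 0 = x (- int n)" using x[of "- int n"] n(1) by simp
      also have "\<dots> = y (- int n - int m + int m)" using eq n(1) by simp
      also have "\<dots> = y (- int n - int m)" using m(1) n(1) by (intro y) auto
      also have "\<dots> = x (- int n - int m)" using eq n(1) m(1) by simp
      also have "\<dots> = x (- int n - int m + int n)" using m(1) n(1) by (intro x[symmetric]) auto
      also have "\<dots> = y (- int m)" using eq m(1) by simp
      also have "\<dots> = y 0" using y[of "- int m"] m(1) by simp
      finally show ?thesis .
    next
      case False
      then have "x = y" using K p by (auto simp: branching_pasts_def)
      then show ?thesis by simp
    qed
  qed
qed

end

text \<open>Once every preimage of \<open>Z\<close> is removed, the coordinate at \<open>n\<close>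
  is the next symbol of the \<open>n\<close>-th shift, and the pasts of these shifts agree by
  induction.\<close>

lemma past_determines_point:
  assumes M: "invariant_prob_measure k M" and Z: "Z \<in> null_sets M"
    and det: "\<And>x y. x \<in> space M - Z \<Longrightarrow> y \<in> space M - Z \<Longrightarrow> (\<forall>l<0. x l = y l) \<Longrightarrow> x 0 = y 0"
  obtains Z' where "Z' \<in> null_sets M"
    "\<And>x y. x \<in> space M - Z' \<Longrightarrow> y \<in> space M - Z' \<Longrightarrow> (\<forall>l<0. x l = y l) \<Longrightarrow> x = y"
proof
  have Ms: "sets M = sets (restrict_space borel (Sigma_space k))"
    using M by (auto simp: invariant_prob_measure_def)
  note T = measurable_left_shift_funpow[OF Ms]
  define Z' where "Z' = (\<Union>n. (left_shift ^^ n) -` Z \<inter> space M)"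
  have "(left_shift ^^ n) -` Z \<inter> space M \<in> null_sets M" for n
  proof (rule null_setsI)
    have "emeasure (distr M M (left_shift ^^ n)) Z = emeasure M ((left_shift ^^ n) -` Z \<inter> space M)"
      by (rule emeasure_distr[OF T]) (use Z in auto)
    then show "emeasure M ((left_shift ^^ n) -` Z \<inter> space M) = 0"
      using Z by (simp add: invariant_prob_measure_funpow[OF M] null_setsD1)
  qed (use measurable_sets[OF T] Z in auto)
  then show "Z' \<in> null_sets M" unfolding Z'_def by (rule null_sets_UN)
  fix x y assume xy: "x \<in> space M - Z'" "y \<in> space M - Z'" and past: "\<forall>l<0. x l = y l"
  have nonneg: "x (int n) = y (int n)" for n
  proof (induction n rule: less_induct)
    case (less n)
    have "x (l + int n) = y (l + int n)" if "l < 0" for l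
    proof (cases "l + int n < 0")
      case False
      then have "nat (l + int n) < n" "int (nat (l + int n)) = l + int n" using that by auto
      then show ?thesis using less by metis
    qed (use past in simp)
    moreover have "(left_shift ^^ n) z \<in> space M - Z" if "z \<in> space M - Z'" for z
      using that measurable_space[OF T, of z n] by (auto simp: Z'_def)
    ultimately have "((left_shift ^^ n) x) 0 = ((left_shift ^^ n) y) 0"
      using xy by (intro det) (auto simp: left_shift_funpow)
    then show ?case by (simp add: left_shift_funpow)
  qed
  show "x = y"
  proof
    fix l show "x l = y l" using past nonneg[of "nat l"] by (cases "l < 0") auto
  qed
qed

section \<open>Coding of arbitrary finite partitions\<close>

lemma simple_function_symbol:
  assumes M: "sets M = sets (restrict_space borel (Sigma_space k))"
  shows "simple_function M (\<lambda>x. x l)"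
  unfolding simple_function_def
proof (intro conjI ballI)
  have "(\<lambda>x. x l) ` space M \<subseteq> {1..k}" by (auto simp: space_shift_measure[OF M] Sigma_space_def)
  then show "finite ((\<lambda>x. x l) ` space M)" by (rule finite_subset) simp
  show "(\<lambda>x. x l) -` {i} \<inter> space M \<in> sets M" for i
    unfolding sets_shift_measure_iff[OF M] space_shift_measure[OF M]
    using closed_Collect_coordinate[of l "{i}"] closed_Sigma_space by (auto simp: vimage_def)
qed

lemma simple_function_word:
  assumes M: "sets M = sets (restrict_space borel (Sigma_space k))"
  shows "simple_function M (\<lambda>x. map x ls)"
proof (induction ls)
  case (Cons l ls)
  show ?case
    using simple_function_compose[OF simple_function_Pair[OF simple_function_symbol[OF M, of l] Cons],
        of "\<lambda>(i, w). i # w"]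
    by (simp add: comp_def)
qed simp

text \<open>Outside a small set \<open>B\<close> a finite window predicts the next symbol and the
  cell of \<open>P\<close>. The code gives the initial window once and speaks again only on
  \<open>B\<close>; decoding extends the window by one symbol at a time.\<close>

lemma partition_dynamical_entropy_eq_0_if_past_determines:
  assumes M: "invariant_prob_measure k M" and Z: "Z \<in> null_sets M"
    and det: "\<And>x y. x \<in> space M - Z \<Longrightarrow> y \<in> space M - Z \<Longrightarrow> (\<forall>l<0. x l = y l) \<Longrightarrow> x = y"
    and P: "finite_measurable_partition M P"
  shows "partition_dynamical_entropy M left_shift P = 0"
proof -
  have Ms: "sets M = sets (restrict_space borel (Sigma_space k))" and "prob_space M"
    and dM: "distr M M left_shift = M"
    using M by (auto simp: invariant_prob_measure_def)
  interpret prob_space M by fact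
  note T = measurable_left_shift[OF Ms]
  show ?thesis
  proof (rule partition_dynamical_entropy_eq_0[where 'b = "nat list"
        and 'c = "(nat \<times> (int \<Rightarrow> nat) set) option", OF \<open>prob_space M\<close> T dM P])
    fix \<eta> :: real assume \<eta>: "\<eta> > 0"
    \<comment> \<open>The symbol lets the decoding continue, the cell is what it has to
      produce.\<close>
    define f where "f x = (x 0, partition_cell P x)" for x :: "int \<Rightarrow> nat"
    have f: "simple_function M f"
      unfolding f_def by (intro simple_function_Pair simple_function_symbol[OF Ms] simple_function_partition_cell[OF P])
    define F where "F = Some ` f ` space M"
    have F: "finite F" using simple_functionD(1)[OF f] by (simp add: F_def)
    \<comment> \<open>Chosen so that \<open>(1 + 2 * card F) * s \<le> \<eta>\<close>. The minimum
      with \<open>1\<close> gives \<open>s * s \<le> s\<close>, and measure \<open>s * s\<close>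
      makes the square root in \<open>entropy_rare_event_le\<close> equal to
      \<open>s\<close>.\<close>
    define s where "s = min 1 (\<eta> / (1 + 2 * real (card F)))"
    have s: "0 < s" "s \<le> 1" "s \<le> \<eta> / (1 + 2 * real (card F))" using \<eta> by (auto simp: s_def)
    obtain m :: nat and B where B: "B \<in> sets M" "measure M B \<le> s * s"
      and win: "\<And>x y. x \<in> space M - B \<Longrightarrow> y \<in> space M - B \<Longrightarrow> (\<forall>l\<in>{- int m..<0}. x l = y l) \<Longrightarrow> f x = f y"
    proof (rule finite_window_determines[OF \<open>prob_space M\<close> Ms f Z, of "s * s"])
      show "f x = f y" if "x \<in> space M - Z" "y \<in> space M - Z" "\<forall>l<0. x l = y l" for x y
        using det[OF that] by simp
      show "s * s > 0" using s by simp
    qed (rule that)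
    define W where "W x = map x [- int m..-1]" for x :: "int \<Rightarrow> nat"
    define D where "D x = (if x \<in> B then Some (f x) else None)" for x
    have W: "simple_function M W" unfolding W_def by (rule simple_function_word[OF Ms])
    have D: "simple_function M D"
      unfolding D_def
      using simple_function_compose[OF f, of Some] B(1)
      by (intro simple_function_If_set) (auto simp: comp_def)
    have HD: "prob_space.entropy M (exp 1) (count_space (D ` space M)) D \<le> \<eta>"
    proof -
      have BB: "{x \<in> space M. D x \<noteq> None} = B" using sets.sets_into_space[OF B(1)] by (auto simp: D_def)
      have "prob_space.entropy M (exp 1) (count_space (D ` space M)) D
          \<le> s * s + real (card F) * (2 * sqrt (s * s))"
      proof (rule entropy_rare_event_le[OF \<open>prob_space M\<close> D F])
        show "D ` space M \<subseteq> insert None F" by (auto simp: D_def F_def)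
        show "measure M {x \<in> space M. D x \<noteq> None} \<le> s * s" unfolding BB by (rule B(2))
      qed
      also have "\<dots> \<le> s + real (card F) * (2 * s)"
        using s mult_left_mono[of s 1 s] by (simp add: real_sqrt_mult)
      also have "\<dots> = (1 + 2 * real (card F)) * s" by (simp add: algebra_simps)
      also have "\<dots> \<le> \<eta>" using s(3) by (simp add: field_simps add_pos_nonneg)
      finally show ?thesis .
    qed
    have decode: "\<forall>i<n. partition_cell P ((left_shift ^^ i) x) = partition_cell P ((left_shift ^^ i) y)"
      if xy: "x \<in> space M" "y \<in> space M" and eqW: "W x = W y"
        and eqD: "\<forall>i<n. D ((left_shift ^^ i) x) = D ((left_shift ^^ i) y)" for n x y
    proof -
      \<comment> \<open>The window of the \<open>i\<close>-th shift covers the positions from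
        \<open>i - m\<close> to \<open>i - 1\<close>, all of them already decoded.\<close>
      have step: "f ((left_shift ^^ i) x) = f ((left_shift ^^ i) y)"
        if i: "i < n" and ag: "\<forall>l\<in>{- int m..<int i}. x l = y l" for i
      proof (cases "(left_shift ^^ i) x \<in> B")
        case True
        then show ?thesis using eqD i by (auto simp: D_def split: if_splits)
      next
        case False
        then have "(left_shift ^^ i) y \<notin> B" using eqD i by (auto simp: D_def split: if_splits)
        moreover have "(left_shift ^^ i) z \<in> space M" if "z \<in> space M" for z
          using measurable_space[OF measurable_left_shift_funpow[OF Ms] that] .
        ultimately show ?thesis
          using False xy ag by (intro win) (auto simp: left_shift_funpow)
      qed
      have agree: "i \<le> n \<Longrightarrow> \<forall>l\<in>{- int m..<int i}. x l = y l" for i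
      proof (induction i)
        case 0
        show ?case using eqW by (auto simp: W_def)
      next
        case (Suc i)
        then have ag: "\<forall>l\<in>{- int m..<int i}. x l = y l" by simp
        have "f ((left_shift ^^ i) x) = f ((left_shift ^^ i) y)" by (rule step) (use Suc ag in auto)
        then have "x (int i) = y (int i)" by (simp add: f_def left_shift_funpow)
        show ?case
        proof
          fix l assume "l \<in> {- int m..<int (Suc i)}"
          then have "l = int i \<or> l \<in> {- int m..<int i}" by auto
          then show "x l = y l" using \<open>x (int i) = y (int i)\<close> ag by blast
        qed
      qed
      have "f ((left_shift ^^ i) x) = f ((left_shift ^^ i) y)" if "i < n" for i
        using step[OF that agree] that by simp
      then show ?thesis by (simp add: f_def)
    qed
    show "\<exists>(W :: (int \<Rightarrow> nat) \<Rightarrow> nat list) (D :: (int \<Rightarrow> nat) \<Rightarrow> (nat \<times> (int \<Rightarrow> nat) set) option).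
        simple_function M W \<and> simple_function M D \<and>
        prob_space.entropy M (exp 1) (count_space (D ` space M)) D \<le> \<eta> \<and>
        (\<forall>n. \<forall>x\<in>space M. \<forall>y\<in>space M. W x = W y \<longrightarrow>
          (\<forall>i<n. D ((left_shift ^^ i) x) = D ((left_shift ^^ i) y)) \<longrightarrow>
          (\<forall>i<n. partition_cell P ((left_shift ^^ i) x) = partition_cell P ((left_shift ^^ i) y)))"
      by (rule exI[of _ W], rule exI[of _ D], intro conjI W D HD allI ballI impI) (rule decode[THEN spec, THEN mp]; assumption)
  qed
qed

lemma KS_entropy_eq_0I:
  assumes "prob_space M"
    and zero: "\<And>P. finite_measurable_partition M P \<Longrightarrow> partition_dynamical_entropy M T P = 0"
  shows "KS_entropy M T = 0"
proof -
  interpret prob_space M by fact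
  \<comment> \<open>The trivial partition shows that the supremum is not over the empty set, where
    it would be \<open>-\<infinity>\<close> in \<open>ereal\<close>.\<close>
  have "finite_measurable_partition M {space M}"
    using not_empty by (auto simp: finite_measurable_partition_def partition_on_def)
  then have ne: "{P. finite_measurable_partition M P} \<noteq> {}" by blast
  have "KS_entropy M T = (SUP P\<in>{P. finite_measurable_partition M P}. 0)"
    unfolding KS_entropy_def
  proof (rule SUP_cong[OF refl])
    fix P assume "P \<in> {P. finite_measurable_partition M P}"
    then have "partition_dynamical_entropy M T P = 0" using zero[of P] by simp
    then show "ereal (partition_dynamical_entropy M T P) = 0"
      by (simp only: zero_ereal_def)
  qed
  also have "\<dots> = 0" by (rule SUP_const[OF ne])
  finally show ?thesis .
qed

theorem theorem1p4:
  fixes k :: nat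
    and A :: "nat \<Rightarrow> real^2^2"
    and e1 e2 :: "(int \<Rightarrow> nat) \<Rightarrow> (real^2) set"
  assumes SL2: "\<forall>i\<in>{1..k}. det (A i) = 1"
    and pinching: "pinching k A"
    and twisting: "twisting k A"
    and splitting: "dominated_splitting A (mather_set k A) e1 e2"
    and e1_inj: "\<forall>x\<in>mather_set k A. \<forall>y\<in>mather_set k A. e1 x = e1 y \<longrightarrow> (\<forall>l<0. x l = y l)"
    and e2_inj: "\<forall>x\<in>mather_set k A. \<forall>y\<in>mather_set k A. e2 x = e2 y \<longrightarrow> (\<forall>l\<ge>0. x l = y l)"
  shows "\<forall>\<mu>. lyapunov_maximizing k A \<mu> \<longrightarrow> KS_entropy \<mu> left_shift = 0"
proof (intro allI impI)
  fix \<mu> assume \<mu>: "lyapunov_maximizing k A \<mu>"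
  then have inv: "invariant_prob_measure k \<mu>" by (simp add: lyapunov_maximizing_def)
  obtain N C where N: "\<And>v. norm v \<le> N v" "\<And>v. N v \<le> C * norm v" "\<And>u v. N (u + v) \<le> N u + N v"
    "\<And>t v. N (t *\<^sub>R v) = \<bar>t\<bar> * N v"
    "\<And>i v. i \<in> {1..k} \<Longrightarrow> N (A i *v v) \<le> exp (max_lyapunov_exponent k A) * N v"
    using extremal_norm_exists[OF SL2 twisting] by blast
  have e: "continuous_map (top_of_set (mather_set k A)) projective_line e1"
    "continuous_map (top_of_set (mather_set k A)) projective_line e2"
    "\<And>\<omega>. \<omega> \<in> mather_set k A \<Longrightarrow> direct_sum_decomposition (e1 \<omega>) (e2 \<omega>)"
    "\<And>\<omega>. \<omega> \<in> mather_set k A \<Longrightarrow> (*v) (A (\<omega> 0)) ` e1 \<omega> = e1 (left_shift \<omega>)"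
    "\<And>\<omega>. \<omega> \<in> mather_set k A \<Longrightarrow> (*v) (A (\<omega> 0)) ` e2 \<omega> = e2 (left_shift \<omega>)"
    using splitting unfolding dominated_splitting_def by blast+
  obtain c \<delta> where dom: "c > 0" "0 < \<delta>"
    "\<And>\<omega> n. \<omega> \<in> mather_set k A \<Longrightarrow> n \<ge> 1 \<Longrightarrow>
      norm_on (cocycle A n \<omega>) (e1 \<omega>) \<ge> c * exp (\<delta> * real n) * norm_on (cocycle A n \<omega>) (e2 \<omega>)"
    using splitting unfolding dominated_splitting_def by blast
  interpret extremal_splitting k A e1 e2 N C c \<delta>
    by (rule extremal_splitting.intro[OF SL2 N e dom])
  have "countable branching_pasts"
    by (rule countable_branching_pasts) (use e1_inj e2_inj in blast)+
  then obtain Z where Z: "Z \<in> null_sets \<mu>"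
    "\<And>x y. x \<in> space \<mu> - Z \<Longrightarrow> y \<in> space \<mu> - Z \<Longrightarrow> (\<forall>l<0. x l = y l) \<Longrightarrow> x 0 = y 0"
    using past_determines_next_symbol[OF \<mu>] by blast
  obtain Z' where Z': "Z' \<in> null_sets \<mu>"
    "\<And>x y. x \<in> space \<mu> - Z' \<Longrightarrow> y \<in> space \<mu> - Z' \<Longrightarrow> (\<forall>l<0. x l = y l) \<Longrightarrow> x = y"
  proof (rule past_determines_point[OF inv Z(1)])
    show "x 0 = y 0" if "x \<in> space \<mu> - Z" "y \<in> space \<mu> - Z" "\<forall>l<0. x l = y l" for x y
      by (rule Z(2)[OF that])
  qed (rule that)
  show "KS_entropy \<mu> left_shift = 0"
  proof (rule KS_entropy_eq_0I)
    show "prob_space \<mu>" using inv by (simp add: invariant_prob_measure_def)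
    show "partition_dynamical_entropy \<mu> left_shift P = 0" if "finite_measurable_partition \<mu> P" for P
      using Z' that by (intro partition_dynamical_entropy_eq_0_if_past_determines[OF inv])
  qed
qed

end
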